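(* Let $d$ be a positive integer and let $T_1,\dots,T_d:[0,1]\to[0,1]$ be regular uniform-distribution-preserving (udp) transformations. Let $\boldsymbol V=(V_1,\dots,V_d)^\top$ and $\boldsymbol Z=(Z_1,\dots,Z_d)^\top$ be random vectors on a common probability space, each having (possibly dependent) components that are uniformly distributed on $(0,1)$, such that for each $i\in\{1,\dots,d\}$ the random variables $V_i$ and $Z_i$ are independent. Suppose that $\boldsymbol V$ is distributed according to a copula with density $c_{\boldsymbol V}$ with respect to Lebesgue measure. Then the multivariate stochastic inverse $$\boldsymbol U=\bigl(T_1^{\leftarrow}(V_1,Z_1),\dots,T_d^{\leftarrow}(V_d,Z_d)\bigr)^\top$$ is distributed according to a copula with density $$c_{\boldsymbol U}(u_1,\dots,u_d)=c_{\boldsymbol V}\bigl(T_1(u_1),\dots,T_d(u_d)\bigr)\,\omega(u_1,\dots,u_d),$$ where, for $\boldsymbol u=(u_1,\dots,u_d)^\top$ and $\mathcal T(\boldsymbol u)=(T_1(u_1),\dots,T_d(u_d))^\top$, $$\omega(u_1,\dots,u_d)=\sum_{\ell_1=1}^{L_1}\cdots\sum_{\ell_d=1}^{L_d} I_{\{\boldsymbol u\in A_{1\ell_1}\times\cdots\times A_{d\ell_d}\}}\;p_{\ell_1,\dots,\ell_d}(\mathcal T(\boldsymbol u))\prod_{i=1}^d|T_i'(u_i)| .$$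
   Context: A transformation $T:[0,1]\to[0,1]$ is uniform distribution preserving (udp) if $T(U)\sim\mathcal U(0,1)$ whenever $U\sim\mathcal U(0,1)$. A udp transformation is regular if there is a finite partition $0=a_0<a_1<\dots<a_{L-1}<a_L=1$, $L\in\{1,2,\dots\}$, such that $T$ is continuously differentiable on each open interval $A_\ell=(a_{\ell-1},a_\ell)$, $\ell=1,\dots,L$. Write $A^{\cup}=\bigcup_{\ell=1}^L A_\ell$. A copula is a distribution function on $[0,1]^d$ with uniform margins. Stochastic inverse. Let $T$ be a regular udp transformation with a fixed finite partition $0=a_0<a_1<\dots<a_{L-1}<a_L=1$ such that $T$ is continuously differentiable on each open interval $A_\ell=(a_{\ell-1},a_\ell)$, $\ell=1,\dots,L$, and $A^{\cup}=\bigcup_{\ell=1}^L A_\ell$. For $v\in(0,1)$ let $\{r_1(v),\dots,r_{n(v)}(v)\}=\{u\in A^{\cup}:T(u)=v\}$ (a finite set), and let $G(x,v)=\sum_{i:\,r_i(v)\le x}1/|T'(r_i(v))|$ for $x\in[0,1]$. For all $v$ outside a Lebesgue-null set, $v\in T(A^\cup)$ and the weights $1/|T'(r_i(v))|$ sum to one, so that $G(\cdot,v)$ is the distribution function of a discrete random variable with support $\{r_1(v),\dots,r_{n(v)}(v)\}$ and these probabilities. For such $v$ and $z\in[0,1]$, set $T^{\leftarrow}(v,z)=G^{-1}(z,v)=\inf\{x\in[0,1]:G(x,v)\ge z\}$; for all other $v$ set $T^{\leftarrow}(v,z)=0$. Notation for several transformations. For each $i$, a partition on which $T_i$ is regular is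 fixed and denoted $0=a_{i0}<a_{i1}<\dots<a_{iL_i}=1$, and $A_{i\ell}=(a_{i(\ell-1)},a_{i\ell})$ for $\ell=1,\dots,L_i$. $T_i^{\leftarrow}$ is the stochastic inverse of $T_i$ defined using this partition. $I_{\{\cdot\}}$ denotes an indicator. Allocation probabilities. For $\ell_i\in\{1,\dots,L_i\}$, $i=1,\dots,d$, $$p_{\ell_1,\dots,\ell_d}(\boldsymbol v)=\mathbb P\bigl(\boldsymbol U\in A_{1\ell_1}\times\cdots\times A_{d\ell_d}\mid\boldsymbol V=\boldsymbol v\bigr),$$ where $\boldsymbol U=(T_1^{\leftarrow}(V_1,Z_1),\dots,T_d^{\leftarrow}(V_d,Z_d))^\top$. These are computed from a fixed regular conditional distribution $\kappa_{\boldsymbol v}$ (a probability measure on $(0,1)^d$ for every $\boldsymbol v\in(0,1)^d$) of $\boldsymbol Z$ given $\boldsymbol V=\boldsymbol v$, that is, $p_{\ell_1,\dots,\ell_d}(\boldsymbol v)=\kappa_{\boldsymbol v}\bigl(\{\boldsymbol z:T_i^{\leftarrow}(v_i,z_i)\in A_{i\ell_i},\ i=1,\dots,d\}\bigr)$. *)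

theory Defs
  imports "HOL-Probability.Probability"
begin

abbreviation unif01 :: "real measure" where
  "unif01 \<equiv> uniform_measure lborel {0<..<1}"

abbreviation ocube :: "(real ^ 'd) set" where
  "ocube \<equiv> {x. \<forall>i. x $ i \<in> {0<..<1}}"

abbreviation ccube :: "(real ^ 'd) set" where
  "ccube \<equiv> {x. \<forall>i. x $ i \<in> {0..1}}"


section \<open>Regular uniform distribution preserving transformations\<close>

text \<open>A map from [0,1] to [0,1] is a function on all reals whose values outside [0,1] are
  irrelevant. The law of T(U) depends on U only through its law, so the condition is stated
  for the push-forward of the uniform law.\<close>

definition udp :: "(real \<Rightarrow> real) \<Rightarrow> bool" where
  "udp T \<longleftrightarrow> T ` {0..1} \<subseteq> {0..1} \<and>
     T \<in> borel_measurable (restrict_space borel {0..1}) \<and>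
     distr (restrict_space unif01 {0..1}) borel T = unif01"

text \<open>A partition of [0,1] into L intervals is given by its points a 0 < ... < a L.\<close>

definition piece :: "(nat \<Rightarrow> real) \<Rightarrow> nat \<Rightarrow> real set" where
  "piece a l = {a (l - 1) <..< a l}"

definition pieces :: "nat \<Rightarrow> (nat \<Rightarrow> real) \<Rightarrow> real set" where
  "pieces L a = (\<Union>l\<in>{1..L}. piece a l)"

definition regular_on :: "(real \<Rightarrow> real) \<Rightarrow> nat \<Rightarrow> (nat \<Rightarrow> real) \<Rightarrow> bool" where
  "regular_on T L a \<longleftrightarrow> 1 \<le> L \<and> a 0 = 0 \<and> a L = 1 \<and>
     (\<forall>l\<in>{1..L}. a (l - 1) < a l) \<and>
     (\<forall>l\<in>{1..L}. T C1_differentiable_on piece a l)"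

definition regular_udp :: "(real \<Rightarrow> real) \<Rightarrow> bool" where
  "regular_udp T \<longleftrightarrow> udp T \<and> (\<exists>L a. regular_on T L a)"


section \<open>Stochastic inverse\<close>

definition preimages :: "(real \<Rightarrow> real) \<Rightarrow> nat \<Rightarrow> (nat \<Rightarrow> real) \<Rightarrow> real \<Rightarrow> real set" where
  "preimages T L a v = {u \<in> pieces L a. T u = v}"

definition inv_cdf :: "(real \<Rightarrow> real) \<Rightarrow> nat \<Rightarrow> (nat \<Rightarrow> real) \<Rightarrow> real \<Rightarrow> real \<Rightarrow> real" where
  "inv_cdf T L a x v = (\<Sum>r\<in>{r \<in> preimages T L a v. r \<le> x}. 1 / \<bar>deriv T r\<bar>)"

definition stoch_inv :: "(real \<Rightarrow> real) \<Rightarrow> nat \<Rightarrow> (nat \<Rightarrow> real) \<Rightarrow> real \<Rightarrow> real \<Rightarrow> real" where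
  "stoch_inv T L a v z =
     (if v \<in> {0<..<1} \<and> v \<in> T ` pieces L a \<and>
         (\<Sum>r\<in>preimages T L a v. 1 / \<bar>deriv T r\<bar>) = 1
      then Inf {x \<in> {0..1}. z \<le> inv_cdf T L a x v}
      else 0)"


section \<open>Copulas and densities\<close>

text \<open>A copula is a function on the closed unit cube; values elsewhere are irrelevant.\<close>

definition copula :: "(real ^ 'd::finite \<Rightarrow> real) \<Rightarrow> bool" where
  "copula C \<longleftrightarrow> (\<exists>\<mu> :: (real ^ 'd) measure. prob_space \<mu> \<and> sets \<mu> = sets borel \<and>
     (\<forall>i. distr \<mu> borel (\<lambda>x. x $ i) = unif01) \<and>
     (\<forall>u\<in>ccube. C u = measure \<mu> {x. \<forall>i. x $ i \<le> u $ i}))"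

definition joint_cdf :: "'w measure \<Rightarrow> ('w \<Rightarrow> real ^ 'd::finite) \<Rightarrow> real ^ 'd \<Rightarrow> real" where
  "joint_cdf M X u = measure M {w \<in> space M. \<forall>i. X w $ i \<le> u $ i}"

text \<open>The density is taken as a function on the whole space, hence it vanishes almost
  everywhere outside the unit cube.\<close>

definition has_copula_density ::
  "'w measure \<Rightarrow> ('w \<Rightarrow> real ^ 'd::finite) \<Rightarrow> (real ^ 'd \<Rightarrow> real) \<Rightarrow> bool" where
  "has_copula_density M X c \<longleftrightarrow> copula (joint_cdf M X) \<and>
     (\<forall>x. 0 \<le> c x) \<and> distributed M lborel X (\<lambda>x. ennreal (c x))"


section \<open>Allocation probabilities and the density factor\<close>

text \<open>\<kappa> is a regular conditional distribution of Z given V, as a probability kernel on the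
  open unit cube.\<close>

definition reg_cond_dist ::
  "'w measure \<Rightarrow> ('w \<Rightarrow> real ^ 'd::finite) \<Rightarrow> ('w \<Rightarrow> real ^ 'd) \<Rightarrow>
   (real ^ 'd \<Rightarrow> (real ^ 'd) measure) \<Rightarrow> bool" where
  "reg_cond_dist M Z V \<kappa> \<longleftrightarrow>
     \<kappa> \<in> measurable (restrict_space borel ocube) (prob_algebra (restrict_space borel ocube)) \<and>
     (\<forall>A B. A \<in> sets borel \<and> A \<subseteq> ocube \<and> B \<in> sets borel \<and> B \<subseteq> ocube \<longrightarrow>
        emeasure M {w \<in> space M. V w \<in> A \<and> Z w \<in> B} =
        (\<integral>\<^sup>+v\<in>A. emeasure (\<kappa> v) B \<partial>distr M borel V))"

text \<open>The kernel is available on the open cube only. Outside it the allocation probabilities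
  are set to 0; this affects the density below only on a Lebesgue-null set, because a udp
  transformation takes the values 0 and 1 on null sets only.\<close>

definition alloc_prob ::
  "(real ^ 'd \<Rightarrow> (real ^ 'd::finite) measure) \<Rightarrow> ('d \<Rightarrow> real \<Rightarrow> real) \<Rightarrow> ('d \<Rightarrow> nat) \<Rightarrow>
   ('d \<Rightarrow> nat \<Rightarrow> real) \<Rightarrow> ('d \<Rightarrow> nat) \<Rightarrow> real ^ 'd \<Rightarrow> real" where
  "alloc_prob \<kappa> T L a l v =
     (if v \<in> ocube
      then measure (\<kappa> v)
        {z \<in> ocube. \<forall>i. stoch_inv (T i) (L i) (a i) (v $ i) (z $ i) \<in> piece (a i) (l i)}
      else 0)"

definition map_vec :: "('d \<Rightarrow> real \<Rightarrow> real) \<Rightarrow> real ^ 'd::finite \<Rightarrow> real ^ 'd" where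
  "map_vec T u = (\<chi> i. T i (u $ i))"

definition omega ::
  "(real ^ 'd \<Rightarrow> (real ^ 'd::finite) measure) \<Rightarrow> ('d \<Rightarrow> real \<Rightarrow> real) \<Rightarrow> ('d \<Rightarrow> nat) \<Rightarrow>
   ('d \<Rightarrow> nat \<Rightarrow> real) \<Rightarrow> real ^ 'd \<Rightarrow> real" where
  "omega \<kappa> T L a u =
     (\<Sum>l\<in>(\<Pi>\<^sub>E i\<in>UNIV. {1..L i}).
        indicator {u. \<forall>i. u $ i \<in> piece (a i) (l i)} u *
        alloc_prob \<kappa> T L a l (map_vec T u) *
        (\<Prod>i\<in>UNIV. \<bar>deriv (T i) (u $ i)\<bar>))"

end

theory Submission
  imports Defs
begin

text \<open>
  The key observation is that a regular udp transformation \<open>T\<close> satisfies \<open>\<bar>T'\<bar> \<ge> 1\<close> on every piece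
  (\<open>one_le_abs_deriv\<close>): where \<open>\<bar>T'\<bar> < 1\<close>, a small interval would be mapped into a shorter one, whose
  preimage is then too long. Hence \<open>T\<close> is injective on each piece, every value has at most one root per
  piece, and the roots of \<open>v\<close> are the values of finitely many inverse branches. Comparing the density of
  \<open>T(U)\<close>, computed by change of variables along the branches, with the uniform density shows that the
  weights \<open>1 / \<bar>T'\<bar>\<close> at the roots of \<open>v\<close> sum to one for almost every \<open>v\<close> (\<open>AE_cum_eq_1\<close>).

  For such \<open>v\<close> the distribution function of the roots is a step function whose jumps occur at the roots,
  in the order of the pieces. Its generalised inverse therefore selects the root in the \<open>k\<close>-th piece
  exactly for the levels \<open>z\<close> in a half-open interval whose length is the weight of that root; this
  interval is called the stratum of \<open>k\<close>. Since \<open>V\<^sub>i\<close> and \<open>Z\<^sub>i\<close> are independent and uniform, integrating the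
  stratum lengths gives back Lebesgue measure on each piece, so the margins of \<open>U\<close> are uniform
  (\<open>distr_stoch_inv\<close>).

  For the joint law, fix a cell, that is, a choice of one piece in every coordinate. On the cell the
  coordinatewise map is injective, and almost surely the vector \<open>U\<close> lies in the cell exactly if each \<open>Z\<^sub>i\<close> lies in the
  stratum of the chosen piece; in that case \<open>U\<close> is the branch inverse of \<open>V\<close>. The conditional probability
  of this event given \<open>V = v\<close> is the allocation probability, so the part of the law of \<open>U\<close> inside the
  cell is the image, under the branch inverse, of the law of \<open>V\<close> weighted by the allocation probability
  (\<open>reg_cond_dist_emeasure\<close>). A change of variables (\<open>nn_integral_cell\<close>) turns this into the density
  \<open>c\<^sub>V\<close> composed with the coordinatewise map, times the allocation probability, times the product of the
  \<open>\<bar>T\<^sub>i'\<bar>\<close>. Summing over the cells gives the formula (\<open>distributed_stoch_inv_vec\<close>).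
\<close>


section \<open>The uniform law on the open unit interval\<close>

lemma prob_space_unif01: "prob_space unif01"
  by (rule prob_space_uniform_measure) auto

lemma nn_integral_unif01:
  "f \<in> borel_measurable borel \<Longrightarrow> (\<integral>\<^sup>+x. f x \<partial>unif01) = (\<integral>\<^sup>+x. f x * indicator {0<..<1} x \<partial>lborel)"
  by (subst nn_integral_uniform_measure) (auto simp: divide_ennreal_def)

lemma AE_unif01: "AE x in unif01. x \<in> {0<..<1}"
  by (rule AE_uniform_measureI) auto

lemma emeasure_unif01_Ioc:
  assumes "0 \<le> c" "c \<le> d" "d \<le> 1"
  shows "emeasure unif01 {c<..d} = ennreal (d - c)"
proof -
  have "emeasure unif01 {c<..d} = emeasure lborel ({0<..<1} \<inter> {c<..d})"
    by (subst emeasure_uniform_measure) (auto simp: divide_ennreal_def)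
  also have "\<dots> = ennreal (d - c)"
  \<comment> \<open>the endpoint 1 belongs to the half-open interval but not to the open unit interval\<close>
  proof (cases "d = 1")
    case True
    then have "{0<..<1} \<inter> {c<..d} = {c<..<d}" using assms by auto
    then show ?thesis using assms by simp
  next
    case False
    then have "{0<..<1} \<inter> {c<..d} = {c<..d}" using assms by auto
    then show ?thesis using assms by simp
  qed
  finally show ?thesis .
qed


section \<open>Pieces of a regular udp transformation\<close>

locale udp_partition =
  fixes T :: "real \<Rightarrow> real" and L :: nat and a :: "nat \<Rightarrow> real"
  assumes udp: "udp T" and regular: "regular_on T L a"
begin

lemma partition_mono: "i \<le> j \<Longrightarrow> j \<le> L \<Longrightarrow> a i \<le> a j"
proof (induction j rule: dec_induct)
  case (step n)
  then have "Suc n \<in> {1..L}" by simp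
  then have "a (Suc n - 1) < a (Suc n)" using regular unfolding regular_on_def by blast
  with step show ?case by simp
qed simp

lemma piece_subset_unit: "l \<in> {1..L} \<Longrightarrow> piece a l \<subseteq> {0<..<1}"
  using partition_mono[of 0 "l - 1"] partition_mono[of l L] regular
  by (force simp: piece_def regular_on_def)

lemma piece_less:
  assumes "k < l" "l \<in> {1..L}" "x \<in> piece a k" "y \<in> piece a l"
  shows "x < y"
  using assms partition_mono[of k "l - 1"] by (force simp: piece_def)

lemma piece_unique:
  assumes "k \<in> {1..L}" "l \<in> {1..L}" "x \<in> piece a k" "x \<in> piece a l"
  shows "k = l"
  using piece_less[of k l x x] piece_less[of l k x x] assms
  by (cases k l rule: linorder_cases) auto

text \<open>The pieces miss only the partition points, which are finitely many and hence negligible for every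
  integral below.\<close>

lemma pieces_exhaust: "{0<..<1} - a ` {..L} \<subseteq> pieces L a"
proof
  fix x assume x: "x \<in> {0<..<1} - a ` {..L}"
  define l where "l = (LEAST l. x < a l)"
  have aL: "x < a L" using x regular by (auto simp: regular_on_def)
  have xl: "x < a l" unfolding l_def using aL by (rule LeastI)
  have lL: "l \<le> L" unfolding l_def using aL by (rule Least_le)
  have l0: "l \<noteq> 0" using xl x regular by (cases l) (auto simp: regular_on_def)
  then have "l - 1 < l" by simp
  then have "\<not> x < a (l - 1)" unfolding l_def by (rule not_less_Least)
  moreover have "x \<noteq> a (l - 1)" using x lL by auto
  ultimately have "x \<in> piece a l" using xl by (auto simp: piece_def)
  then show "x \<in> pieces L a" using l0 lL by (auto simp: pieces_def)
qed

lemma T_deriv: "l \<in> {1..L} \<Longrightarrow> x \<in> piece a l \<Longrightarrow> (T has_real_derivative deriv T x) (at x)"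
  using regular unfolding regular_on_def C1_differentiable_on_def
  by (metis DERIV_imp_deriv has_real_derivative_iff_has_vector_derivative)

lemma deriv_continuous:
  assumes "l \<in> {1..L}" shows "continuous_on (piece a l) (deriv T)"
proof -
  obtain D where D: "\<forall>x\<in>piece a l. (T has_vector_derivative D x) (at x)" "continuous_on (piece a l) D"
    using regular assms unfolding regular_on_def C1_differentiable_on_def by blast
  have "deriv T x = D x" if "x \<in> piece a l" for x
    using D(1) that by (metis DERIV_imp_deriv has_real_derivative_iff_has_vector_derivative)
  then show ?thesis using D(2) by (metis continuous_on_cong)
qed

lemma T_continuous: "l \<in> {1..L} \<Longrightarrow> continuous_on (piece a l) T"
  using T_deriv by (meson DERIV_isCont continuous_at_imp_continuous_on)

lemma T_measurable_unit: "T \<in> borel_measurable (restrict_space borel {0..1})"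
  using udp by (simp add: udp_def)

lemma T_preimage_sets:
  assumes B: "B \<in> sets borel"
  shows "{u\<in>{0<..<1}. T u \<in> B} \<in> sets borel"
proof -
  have "T -` B \<inter> {0..1} \<in> sets (restrict_space borel {0..1})"
    using measurable_sets[OF T_measurable_unit B] by (simp add: space_restrict_space)
  then have "T -` B \<inter> {0..1} \<in> sets borel"
    by (subst (asm) sets_restrict_space_iff) auto
  then have "{0<..<1} \<inter> (T -` B \<inter> {0..1}) \<in> sets borel" by auto
  moreover have "{0<..<1} \<inter> (T -` B \<inter> {0..1}) = {u\<in>{0<..<1}. T u \<in> B}" by auto
  ultimately show ?thesis by simp
qed

lemma T_preserves_lborel:
  assumes B: "B \<in> sets borel"
  shows "emeasure lborel {u\<in>{0<..<1}. T u \<in> B} = emeasure lborel (B \<inter> {0<..<1})"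
proof -
  have m: "T \<in> measurable (restrict_space unif01 {0..1}) borel"
    using T_measurable_unit
    by (subst measurable_cong_sets[where M'="restrict_space borel {0..1}"])
       (auto simp: sets_restrict_space)
  have s: "T -` B \<inter> {0..1} \<in> sets borel"
    using measurable_sets[OF T_measurable_unit B]
    by (subst (asm) sets_restrict_space_iff) (auto simp: space_restrict_space)
  have "emeasure unif01 B = emeasure (distr (restrict_space unif01 {0..1}) borel T) B"
    using udp by (simp add: udp_def)
  also have "\<dots> = emeasure (restrict_space unif01 {0..1}) (T -` B \<inter> {0..1})"
    by (subst emeasure_distr[OF m B]) (simp add: space_restrict_space)
  also have "\<dots> = emeasure unif01 (T -` B \<inter> {0..1})"
    by (subst emeasure_restrict_space) auto
  also have "\<dots> = emeasure lborel ({0<..<1} \<inter> (T -` B \<inter> {0..1}))"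
    using s by (subst emeasure_uniform_measure) (auto simp: divide_ennreal_def)
  also have "{0<..<1} \<inter> (T -` B \<inter> {0..1}) = {u\<in>{0<..<1}. T u \<in> B}" by auto
  finally show ?thesis using B by (simp add: divide_ennreal_def Int_commute)
qed

lemma T_unit: "u \<in> {0..1} \<Longrightarrow> T u \<in> {0..1}"
  using udp unfolding udp_def by blast

text \<open>If \<open>\<bar>T'\<bar> < 1\<close> somewhere on a piece, then by continuity \<open>\<bar>T'\<bar> \<le> c < 1\<close> on a small interval of length
  \<open>2 * e\<close>, which \<open>T\<close> maps into an interval of length \<open>2 * c * e\<close>. The preimage of the latter contains the
  former and so is longer than its target, contradicting that \<open>T\<close> preserves Lebesgue measure.\<close>

lemma one_le_abs_deriv:
  assumes l: "l \<in> {1..L}" and x: "x \<in> piece a l"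
  shows "1 \<le> \<bar>deriv T x\<bar>"
proof (rule ccontr)
  assume "\<not> 1 \<le> \<bar>deriv T x\<bar>"
  then obtain c where c: "\<bar>deriv T x\<bar> < c" "c < 1" "0 < c"
    using dense[of "\<bar>deriv T x\<bar>" 1] by force
  have op: "open (piece a l)" by (simp add: piece_def)
  have "open ((\<lambda>x. \<bar>deriv T x\<bar>) -` {..<c} \<inter> piece a l)"
    using continuous_on_rabs[OF deriv_continuous[OF l]]
    unfolding continuous_on_open_vimage[OF op] by (simp only: open_lessThan)
  then obtain e where e: "e > 0" "cball x e \<subseteq> (\<lambda>x. \<bar>deriv T x\<bar>) -` {..<c} \<inter> piece a l"
    unfolding open_contains_cball using c x by (metis IntI lessThan_iff vimageI)
  let ?J = "{x - e..x + e}"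
  have J: "?J \<subseteq> piece a l" "\<And>y. y \<in> ?J \<Longrightarrow> \<bar>deriv T y\<bar> \<le> c"
    using e(2) by (auto simp: cball_eq_atLeastAtMost subset_eq less_imp_le)
  have J01: "?J \<subseteq> {0<..<1}" using J(1) piece_subset_unit[OF l] by blast
  have lip: "\<bar>T y - T x\<bar> \<le> c * e" if "y \<in> ?J" for y
  proof -
    have "norm (T y - T x) \<le> c * norm (y - x)"
    proof (rule field_differentiable_bound[where S="?J" and f'="deriv T"])
      fix z assume "z \<in> ?J"
      then show "(T has_field_derivative deriv T z) (at z within ?J)" "norm (deriv T z) \<le> c"
        using J by (auto intro!: has_field_derivative_at_within T_deriv[OF l])
    qed (use that e(1) in auto)
    also have "\<dots> \<le> c * e" using that c by (intro mult_left_mono) auto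
    finally show ?thesis by simp
  qed
  let ?K = "{T x - c * e..T x + c * e}"
  have "ennreal (2 * e) = emeasure lborel ?J" using e(1) by simp
  also have "\<dots> \<le> emeasure lborel {u\<in>{0<..<1}. T u \<in> ?K}"
  proof (rule emeasure_mono)
    show "?J \<subseteq> {u\<in>{0<..<1}. T u \<in> ?K}"
    proof
      fix y assume y: "y \<in> ?J"
      then show "y \<in> {u\<in>{0<..<1}. T u \<in> ?K}" using lip[OF y] J01 by (auto simp: abs_le_iff)
    qed
    show "{u\<in>{0<..<1}. T u \<in> ?K} \<in> sets lborel" unfolding sets_lborel by (rule T_preimage_sets) simp
  qed
  also have "\<dots> \<le> emeasure lborel ?K"
    by (subst T_preserves_lborel, simp) (rule emeasure_mono, auto)
  also have "\<dots> = ennreal (2 * (c * e))" using c e(1) by simp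
  finally have "2 * e \<le> 2 * (c * e)" using c e(1) by (subst (asm) ennreal_le_iff) auto
  then show False using c e(1) by simp
qed

text \<open>The derivative has no zero on a piece, so the mean value theorem separates any two points.\<close>

lemma T_inj:
  assumes l: "l \<in> {1..L}"
  shows "inj_on T (piece a l)"
proof (rule linorder_inj_onI)
  fix x y assume xy: "x < y" "x \<in> piece a l" "y \<in> piece a l"
  then have sub: "{x..y} \<subseteq> piece a l" by (auto simp: piece_def)
  obtain z where z: "x < z" "z < y" "T y - T x = (y - x) * deriv T z"
    using MVT2[of x y T "deriv T", OF xy(1) T_deriv[OF l]] sub
    by (metis atLeastAtMost_iff subsetD)
  have "z \<in> piece a l" using z sub by auto
  then have "deriv T z \<noteq> 0" using one_le_abs_deriv[OF l, of z] by auto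
  then show "T x \<noteq> T y" using z xy by auto
qed auto

text \<open>Off the image of the piece the value is immaterial; 0 makes the branch a Borel function on the line.\<close>

definition branch :: "nat \<Rightarrow> real \<Rightarrow> real" where
  "branch l v = (if v \<in> T ` piece a l then the_inv_into (piece a l) T v else 0)"

lemma branch_T: "l \<in> {1..L} \<Longrightarrow> u \<in> piece a l \<Longrightarrow> branch l (T u) = u"
  by (simp add: branch_def the_inv_into_f_f[OF T_inj])

lemma T_branch: "l \<in> {1..L} \<Longrightarrow> v \<in> T ` piece a l \<Longrightarrow> T (branch l v) = v"
  by (auto simp: branch_T)

lemma branch_in: "l \<in> {1..L} \<Longrightarrow> v \<in> T ` piece a l \<Longrightarrow> branch l v \<in> piece a l"
  by (auto simp: branch_T)

lemma T_image_open: "l \<in> {1..L} \<Longrightarrow> open (T ` piece a l)"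
  using T_continuous T_inj by (intro invariance_of_domain) (auto simp: piece_def)

lemma T_image_borel [measurable]: "l \<in> {1..L} \<Longrightarrow> T ` piece a l \<in> sets borel"
  by (rule borel_open[OF T_image_open])

lemma T_image_subset: "l \<in> {1..L} \<Longrightarrow> T ` piece a l \<subseteq> {0<..<1}"
proof -
  assume l: "l \<in> {1..L}"
  have "T ` piece a l \<subseteq> {0..1}"
    using piece_subset_unit[OF l] T_unit by fastforce
  then have "T ` piece a l \<subseteq> interior {0..1}"
    using T_image_open[OF l] by (rule interior_maximal)
  also have "interior {0..1::real} = {0<..<1}" by simp
  finally show ?thesis .
qed

lemma branch_continuous:
  assumes l: "l \<in> {1..L}" shows "continuous_on (T ` piece a l) (branch l)"
proof -
  have "continuous_on (T ` piece a l) (the_inv_into (piece a l) T)"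
    using T_continuous[OF l] T_inj[OF l]
    by (intro continuous_on_inverse_open) (auto simp: piece_def the_inv_into_f_f)
  then show ?thesis
    by (rule continuous_on_eq) (simp add: branch_def)
qed

lemma branch_measurable [measurable]:
  assumes l: "l \<in> {1..L}" shows "branch l \<in> borel_measurable borel"
proof -
  have "(\<lambda>v. if v \<in> T ` piece a l then branch l v else 0) \<in> borel_measurable borel"
    using T_image_borel[OF l] branch_continuous[OF l]
    by (intro borel_measurable_continuous_on_if) auto
  moreover have "(\<lambda>v. if v \<in> T ` piece a l then branch l v else 0) = branch l"
    by (auto simp: branch_def)
  ultimately show ?thesis by simp
qed

lemma abs_deriv_measurable [measurable]:
  assumes l: "l \<in> {1..L}"
  shows "(\<lambda>u. indicator (piece a l) u * \<bar>deriv T u\<bar>) \<in> borel_measurable borel"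
proof -
  have "continuous_on (piece a l) (\<lambda>u. \<bar>deriv T u\<bar>)"
    using deriv_continuous[OF l] by (intro continuous_intros)
  then have "(\<lambda>u. indicator (piece a l) u *\<^sub>R \<bar>deriv T u\<bar>) \<in> borel_measurable borel"
    by (intro borel_measurable_continuous_on_indicator) (simp add: piece_def)
  then show ?thesis by simp
qed

text \<open>The set on the right is the image under \<open>T\<close> of the part of \<open>B\<close> in the piece, so this is the
  one-dimensional change of variables for an injective differentiable map and constant integrand.\<close>

lemma emeasure_T_image:
  assumes l: "l \<in> {1..L}" and B: "B \<in> sets borel"
  shows "(\<integral>\<^sup>+u. indicator B u * ennreal (indicator (piece a l) u * \<bar>deriv T u\<bar>) \<partial>lborel) =
    emeasure lborel {v \<in> T ` piece a l. branch l v \<in> B}"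
proof -
  note [measurable] = T_image_borel[OF l] branch_measurable[OF l] B
  let ?S = "piece a l \<inter> B" and ?R = "{v \<in> T ` piece a l. branch l v \<in> B}"
  have S: "?S \<in> sets borel" using B by (simp add: piece_def)
  have R: "?R \<in> sets borel" by measurable
  have TS: "T ` ?S = ?R" using branch_T[OF l] by auto
  \<comment> \<open>finiteness of the image measure lets the change of variables for absolutely integrable functions apply\<close>
  have R01: "?R \<subseteq> {0..1}" using T_image_subset[OF l] by fastforce
  have "emeasure lborel ?R \<le> emeasure lborel {0..1::real}"
    using R01 by (intro emeasure_mono) auto
  then have fin: "emeasure lborel ?R < \<infinity>" by (simp add: order_le_less_trans)
  then obtain r where r: "emeasure lborel ?R = ennreal r" "0 \<le> r"
    by (cases "emeasure lborel ?R") auto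
  have hi: "((\<lambda>v. 1::real) has_integral r) (T ` ?S)"
    unfolding TS using R r by (simp add: has_integral_iff_emeasure_lborel)
  then have ai: "(\<lambda>v. 1::real) absolutely_integrable_on (T ` ?S)"
    by (intro nonnegative_absolutely_integrable_1) (auto simp: integrable_on_def)
  have inj: "inj_on T ?S" using T_inj[OF l] by (rule inj_on_subset) auto
  have "(\<lambda>x. \<bar>deriv T x\<bar> * 1) absolutely_integrable_on ?S \<and> integral ?S (\<lambda>x. \<bar>deriv T x\<bar> * 1) = r"
  proof (rule has_absolute_integral_change_of_variables_1'[where S="?S" and g'="deriv T"
        and f="\<lambda>_. 1" and g=T and b=r, THEN iffD2])
    show "(T has_field_derivative deriv T x) (at x within ?S)" if "x \<in> ?S" for x
      using that by (intro DERIV_subset[OF T_deriv[OF l]]) auto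
    show "?S \<in> sets lebesgue" using S by (simp add: sets_completionI_sets)
    show "inj_on T ?S" by fact
    show "(\<lambda>v. 1::real) absolutely_integrable_on T ` ?S \<and> integral (T ` ?S) (\<lambda>v. 1) = r"
      using ai integral_unique[OF hi] by (rule conjI)
  qed
  then have "((\<lambda>x. \<bar>deriv T x\<bar>) has_integral r) ?S"
    using set_lebesgue_integral_eq_integral(1) by (auto simp: has_integral_integrable_integral)
  then have "(\<integral>\<^sup>+u. ennreal (indicator ?S u * \<bar>deriv T u\<bar>) \<partial>lborel) = r"
    using nn_integral_has_integral_lebesgue[of ?S "\<lambda>u. \<bar>deriv T u\<bar>" r] by simp
  also have "(\<integral>\<^sup>+u. ennreal (indicator ?S u * \<bar>deriv T u\<bar>) \<partial>lborel) =
    (\<integral>\<^sup>+u. indicator B u * ennreal (indicator (piece a l) u * \<bar>deriv T u\<bar>) \<partial>lborel)"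
    by (intro nn_integral_cong) (auto simp: indicator_def)
  finally show ?thesis using r by simp
qed

text \<open>Change of variables as an identity of measures. In this form it passes to products of pieces, where the
  branches act coordinatewise.\<close>

lemma density_deriv_eq_distr_branch:
  assumes l: "l \<in> {1..L}"
  shows "density lborel (\<lambda>u. ennreal (indicator (piece a l) u * \<bar>deriv T u\<bar>)) =
    distr (density lborel (indicator (T ` piece a l))) borel (branch l)"
proof (rule measure_eqI)
  note [measurable] = T_image_borel[OF l] branch_measurable[OF l] abs_deriv_measurable[OF l]
  fix B assume "B \<in> sets (density lborel (\<lambda>u. ennreal (indicator (piece a l) u * \<bar>deriv T u\<bar>)))"
  then have B [measurable]: "B \<in> sets borel" by simp
  have "emeasure (distr (density lborel (indicator (T ` piece a l))) borel (branch l)) B =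
      emeasure lborel {v \<in> T ` piece a l. branch l v \<in> B}"
  proof -
    have "emeasure (distr (density lborel (indicator (T ` piece a l))) borel (branch l)) B =
        (\<integral>\<^sup>+v. indicator (T ` piece a l) v * indicator (branch l -` B) v \<partial>lborel)"
      using measurable_sets[OF branch_measurable[OF l] B]
      by (subst emeasure_distr) (auto simp: emeasure_density)
    also have "\<dots> = (\<integral>\<^sup>+v. indicator {v \<in> T ` piece a l. branch l v \<in> B} v \<partial>lborel)"
      by (intro nn_integral_cong) (auto simp: indicator_def)
    also have "\<dots> = emeasure lborel {v \<in> T ` piece a l. branch l v \<in> B}"
      by (intro nn_integral_indicator) measurable
    finally show ?thesis .
  qed
  moreover have "emeasure (density lborel (\<lambda>u. ennreal (indicator (piece a l) u * \<bar>deriv T u\<bar>))) B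
      = (\<integral>\<^sup>+u. indicator B u * ennreal (indicator (piece a l) u * \<bar>deriv T u\<bar>) \<partial>lborel)"
    by (subst emeasure_density) (auto simp: mult.commute[of "indicator B _"])
  ultimately show "emeasure (density lborel (\<lambda>u. ennreal (indicator (piece a l) u * \<bar>deriv T u\<bar>))) B =
     emeasure (distr (density lborel (indicator (T ` piece a l))) borel (branch l)) B"
    using emeasure_T_image[OF l B] by simp
qed simp

lemma nn_integral_branch:
  assumes l: "l \<in> {1..L}" and [measurable]: "h \<in> borel_measurable borel"
  shows "(\<integral>\<^sup>+v. indicator (T ` piece a l) v * h (branch l v) \<partial>lborel) =
    (\<integral>\<^sup>+u. ennreal (indicator (piece a l) u * \<bar>deriv T u\<bar>) * h u \<partial>lborel)"
proof -
  note [measurable] = T_image_borel[OF l] branch_measurable[OF l] abs_deriv_measurable[OF l]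
  have "(\<integral>\<^sup>+v. indicator (T ` piece a l) v * h (branch l v) \<partial>lborel) =
    integral\<^sup>N (distr (density lborel (indicator (T ` piece a l))) borel (branch l)) h"
    by (simp add: nn_integral_distr nn_integral_density)
  also have "\<dots> = (\<integral>\<^sup>+u. ennreal (indicator (piece a l) u * \<bar>deriv T u\<bar>) * h u \<partial>lborel)"
    by (simp add: density_deriv_eq_distr_branch[OF l, symmetric] nn_integral_density)
  finally show ?thesis .
qed

text \<open>The probability \<open>1 / \<bar>T'\<bar>\<close> attached to the root of \<open>v\<close> in the piece \<open>l\<close>, or 0 if there is no such root,
  so that sums over roots become sums over pieces.\<close>

definition weight :: "nat \<Rightarrow> real \<Rightarrow> real" where
  "weight l v = (if v \<in> T ` piece a l then 1 / \<bar>deriv T (branch l v)\<bar> else 0)"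

text \<open>Since the pieces are ordered, this is the value of the distribution function of the roots of \<open>v\<close> just
  after the \<open>k\<close>-th piece.\<close>

definition cum :: "nat \<Rightarrow> real \<Rightarrow> real" where
  "cum k v = (\<Sum>l\<in>{1..k}. weight l v)"

lemma weight_nonneg: "0 \<le> weight l v" by (simp add: weight_def)

lemma weight_pos_iff: "l \<in> {1..L} \<Longrightarrow> 0 < weight l v \<longleftrightarrow> v \<in> T ` piece a l"
  using one_le_abs_deriv[of l "branch l v"] branch_in[of l v] by (auto simp: weight_def)

lemma weight_measurable [measurable]:
  assumes l: "l \<in> {1..L}" shows "weight l \<in> borel_measurable borel"
  unfolding weight_def
proof (rule borel_measurable_continuous_on_if)
  have "continuous_on (T ` piece a l) (\<lambda>v. deriv T (branch l v))"
    using branch_in[OF l]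
    by (intro continuous_on_compose2[OF deriv_continuous[OF l] branch_continuous[OF l]]) auto
  then show "continuous_on (T ` piece a l) (\<lambda>v. 1 / \<bar>deriv T (branch l v)\<bar>)"
    using one_le_abs_deriv[OF l] branch_in[OF l] by (intro continuous_intros) fastforce+
qed (use T_image_borel[OF l] in auto)

lemma cum_measurable [measurable]: "k \<le> L \<Longrightarrow> cum k \<in> borel_measurable borel"
  unfolding cum_def by (intro borel_measurable_sum weight_measurable) auto

lemma cum_nonneg: "0 \<le> cum k v" by (simp add: cum_def sum_nonneg weight_nonneg)

lemma cum_mono: "i \<le> j \<Longrightarrow> cum i v \<le> cum j v"
  unfolding cum_def by (intro sum_mono2) (auto simp: weight_nonneg)

lemma cum_step: "1 \<le> k \<Longrightarrow> cum k v = cum (k - 1) v + weight k v"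
  unfolding cum_def by (cases k) auto

lemma cum_0 [simp]: "cum 0 v = 0" by (simp add: cum_def)

text \<open>The weight cancels the derivative that the change of variables produces.\<close>

lemma nn_integral_weight:
  assumes l: "l \<in> {1..L}" and [measurable]: "h \<in> borel_measurable borel"
  shows "(\<integral>\<^sup>+v. ennreal (weight l v) * h (branch l v) \<partial>lborel) =
    (\<integral>\<^sup>+u. indicator (piece a l) u * h u \<partial>lborel)"
proof -
  note [measurable] = abs_deriv_measurable[OF l]
  define g where "g u = ennreal (1 / (indicator (piece a l) u * \<bar>deriv T u\<bar>)) * h u" for u
  have [measurable]: "g \<in> borel_measurable borel" unfolding g_def by measurable
  have "(\<integral>\<^sup>+v. ennreal (weight l v) * h (branch l v) \<partial>lborel) =
     (\<integral>\<^sup>+v. indicator (T ` piece a l) v * g (branch l v) \<partial>lborel)"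
    using branch_in[OF l] by (intro nn_integral_cong) (auto simp: weight_def g_def indicator_def)
  also have "\<dots> = (\<integral>\<^sup>+u. ennreal (indicator (piece a l) u * \<bar>deriv T u\<bar>) * g u \<partial>lborel)"
    by (rule nn_integral_branch[OF l]) measurable
  also have "\<dots> = (\<integral>\<^sup>+u. indicator (piece a l) u * h u \<partial>lborel)"
  proof (intro nn_integral_cong)
    fix u
    show "ennreal (indicator (piece a l) u * \<bar>deriv T u\<bar>) * g u = indicator (piece a l) u * h u"
    proof (cases "u \<in> piece a l")
      case True
      then have "\<bar>deriv T u\<bar> \<noteq> 0" using one_le_abs_deriv[OF l True] by linarith
      then have "ennreal \<bar>deriv T u\<bar> * ennreal (1 / \<bar>deriv T u\<bar>) = 1"
        by (subst ennreal_mult[symmetric]) (auto simp del: abs_eq_0)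
      then show ?thesis using True by (simp add: g_def mult.assoc[symmetric])
    qed simp
  qed
  finally show ?thesis .
qed

lemma sum_over_pieces:
  assumes B: "B \<in> sets borel"
  shows "(\<Sum>l\<in>{1..L}. emeasure lborel (B \<inter> piece a l)) = emeasure lborel (B \<inter> {0<..<1})"
proof -
  have "(\<Sum>l\<in>{1..L}. emeasure lborel (B \<inter> piece a l)) = emeasure lborel (\<Union>l\<in>{1..L}. B \<inter> piece a l)"
  proof (rule sum_emeasure)
    show "disjoint_family_on (\<lambda>l. B \<inter> piece a l) {1..L}"
      using piece_unique unfolding disjoint_family_on_def by blast
  qed (use B in \<open>auto simp: piece_def\<close>)
  also have "\<dots> = emeasure lborel (B \<inter> {0<..<1})"
  proof (rule emeasure_eq_AE)
    have "AE x in lborel. x \<notin> a ` {..L}"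
      by (intro AE_not_in finite_imp_null_set_lborel) auto
    then show "AE x in lborel. x \<in> (\<Union>l\<in>{1..L}. B \<inter> piece a l) \<longleftrightarrow> x \<in> B \<inter> {0<..<1}"
    proof eventually_elim
      case (elim x)
      then show ?case
        using pieces_exhaust piece_subset_unit unfolding pieces_def by blast
    qed
  qed (use B in \<open>auto simp: piece_def\<close>)
  finally show ?thesis .
qed

text \<open>Both sides are densities of the law of \<open>T(U)\<close>: the sum of the weights by change of variables on each
  piece, the constant 1 on the unit interval because \<open>T\<close> preserves the uniform law. Densities are unique
  almost everywhere.\<close>

lemma AE_cum_eq_1: "AE v in lborel. v \<in> {0<..<1} \<longrightarrow> cum L v = 1"
proof -
  have [measurable]: "cum L \<in> borel_measurable borel" by simp
  have "density lborel (\<lambda>v. ennreal (cum L v)) = density lborel (indicator {0<..<1})"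
  proof (rule measure_eqI)
    fix B assume "B \<in> sets (density lborel (\<lambda>v. ennreal (cum L v)))"
    then have B [measurable]: "B \<in> sets borel" by simp
    let ?C = "{u\<in>{0<..<1}. T u \<in> B}"
    have C [measurable]: "?C \<in> sets borel" by (rule T_preimage_sets[OF B])
    have "emeasure (density lborel (\<lambda>v. ennreal (cum L v))) B =
        (\<integral>\<^sup>+v. (\<Sum>l\<in>{1..L}. ennreal (weight l v) * indicator B v) \<partial>lborel)"
    proof -
      have "ennreal (cum L v) * indicator B v = (\<Sum>l\<in>{1..L}. ennreal (weight l v) * indicator B v)" for v
        by (cases "v \<in> B") (simp_all add: cum_def weight_nonneg sum_ennreal)
      then show ?thesis by (simp add: emeasure_density)
    qed
    also have "\<dots> = (\<Sum>l\<in>{1..L}. \<integral>\<^sup>+v. ennreal (weight l v) * indicator B v \<partial>lborel)"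
      by (intro nn_integral_sum) auto
    also have "\<dots> = (\<Sum>l\<in>{1..L}. emeasure lborel (?C \<inter> piece a l))"
    proof (intro sum.cong refl)
      fix l assume l: "l \<in> {1..L}"
      have "(\<integral>\<^sup>+v. ennreal (weight l v) * indicator B v \<partial>lborel) =
         (\<integral>\<^sup>+v. ennreal (weight l v) * indicator ?C (branch l v) \<partial>lborel)"
        using branch_in[OF l] piece_subset_unit[OF l] T_branch[OF l]
        by (intro nn_integral_cong) (auto simp: weight_def indicator_def subset_eq)
      also have "\<dots> = (\<integral>\<^sup>+u. indicator (piece a l) u * indicator ?C u \<partial>lborel)"
        by (rule nn_integral_weight[OF l]) measurable
      also have "\<dots> = (\<integral>\<^sup>+u. indicator (?C \<inter> piece a l) u \<partial>lborel)"
        by (intro nn_integral_cong) (auto simp: indicator_def)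
      also have "\<dots> = emeasure lborel (?C \<inter> piece a l)"
        using C by (intro nn_integral_indicator) (simp add: piece_def)
      finally show "(\<integral>\<^sup>+v. ennreal (weight l v) * indicator B v \<partial>lborel) =
        emeasure lborel (?C \<inter> piece a l)" .
    qed
    also have "\<dots> = emeasure lborel (?C \<inter> {0<..<1})" by (rule sum_over_pieces[OF C])
    also have "?C \<inter> {0<..<1} = ?C" by auto
    also have "emeasure lborel ?C = emeasure lborel (B \<inter> {0<..<1})"
      by (rule T_preserves_lborel[OF B])
    also have "\<dots> = emeasure (density lborel (indicator {0<..<1})) B"
      by (simp add: emeasure_density indicator_inter_arith[symmetric] Int_commute)
    finally show "emeasure (density lborel (\<lambda>v. ennreal (cum L v))) B =
      emeasure (density lborel (indicator {0<..<1})) B" .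
  qed simp
  then have "AE v in lborel. ennreal (cum L v) = indicator {0<..<1} v"
    by (intro sigma_finite_measure.density_unique[OF sigma_finite_lborel]) auto
  then show ?thesis
    by eventually_elim (auto simp: cum_nonneg ennreal_eq_1)
qed


section \<open>Strata and the stochastic inverse\<close>

text \<open>The levels at which the generalised inverse of the distribution function of the roots of \<open>v\<close> picks the
  root in the \<open>k\<close>-th piece: the vertical extent of the jump at that root. It is empty for the exceptional
  \<open>v\<close>, for which the stochastic inverse is set to 0.\<close>

definition stratum :: "nat \<Rightarrow> real \<Rightarrow> real set" where
  "stratum k v = (if v \<in> {0<..<1} \<and> cum L v = 1 then {cum (k - 1) v<..cum k v} else {})"

lemma stratumD:
  assumes "k \<in> {1..L}" "z \<in> stratum k v"
  shows "v \<in> {0<..<1}" "cum L v = 1" "cum (k - 1) v < z" "z \<le> cum k v" "0 < z" "z \<le> 1"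
    "v \<in> T ` piece a k"
proof -
  show *: "v \<in> {0<..<1}" "cum L v = 1" "cum (k - 1) v < z" "z \<le> cum k v"
    using assms(2) by (auto simp: stratum_def split: if_splits)
  show "0 < z" using *(3) cum_nonneg[of "k - 1" v] by linarith
  show "z \<le> 1" using *(2,4) cum_mono[of k L v] assms(1) by auto
  show "v \<in> T ` piece a k"
    using *(3,4) cum_step[of k v] weight_pos_iff[of k v] assms(1) by auto
qed

lemma stratum_unique:
  assumes "z \<in> stratum j v" "z \<in> stratum k v"
  shows "j = k"
proof (rule linorder_cases[of j k])
  assume "j < k"
  then have "j \<le> k - 1" by simp
  then show ?thesis using assms cum_mono[of j "k - 1" v] by (auto simp: stratum_def split: if_splits)
next
  assume "k < j"
  then have "k \<le> j - 1" by simp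
  then show ?thesis using assms cum_mono[of k "j - 1" v] by (auto simp: stratum_def split: if_splits)
qed

lemma stratum_exhaust:
  assumes "v \<in> {0<..<1}" "cum L v = 1" "0 < z" "z \<le> 1"
  obtains k where "k \<in> {1..L}" "z \<in> stratum k v"
proof -
  define k where "k = (LEAST k. z \<le> cum k v)"
  have zL: "z \<le> cum L v" using assms by simp
  have zk: "z \<le> cum k v" unfolding k_def using zL by (rule LeastI)
  have kL: "k \<le> L" unfolding k_def using zL by (rule Least_le)
  have k0: "k \<noteq> 0" using zk assms by (cases k) auto
  then have "k - 1 < k" by simp
  then have "\<not> z \<le> cum (k - 1) v" unfolding k_def by (rule not_less_Least)
  then show ?thesis using that[of k] zk kL k0 assms by (auto simp: stratum_def)
qed

text \<open>There is at most one root per piece, and different pieces carry different roots, so roots may be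
  replaced by indices of pieces.\<close>

lemma sum_preimages:
  "(\<Sum>r\<in>{r \<in> preimages T L a v. P r}. 1 / \<bar>deriv T r\<bar>) =
    (\<Sum>k\<in>{k\<in>{1..L}. v \<in> T ` piece a k \<and> P (branch k v)}. weight k v)"
proof -
  let ?K = "{k\<in>{1..L}. v \<in> T ` piece a k \<and> P (branch k v)}"
  have "{r \<in> preimages T L a v. P r} = (\<lambda>k. branch k v) ` ?K"
  proof (intro equalityI subsetI)
    fix r assume "r \<in> {r \<in> preimages T L a v. P r}"
    then obtain k where "k \<in> {1..L}" "r \<in> piece a k" "T r = v" "P r"
      by (auto simp: preimages_def pieces_def)
    then show "r \<in> (\<lambda>k. branch k v) ` ?K"
      using branch_T[of k r] by (intro image_eqI[of _ _ k]) auto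
  next
    fix r assume "r \<in> (\<lambda>k. branch k v) ` ?K"
    then obtain k where k: "k \<in> {1..L}" "v \<in> T ` piece a k" "P (branch k v)" "r = branch k v" by auto
    then show "r \<in> {r \<in> preimages T L a v. P r}"
      using branch_in[OF k(1,2)] T_branch[OF k(1,2)] by (auto simp: preimages_def pieces_def)
  qed
  moreover have "inj_on (\<lambda>k. branch k v) ?K"
  proof (rule inj_onI)
    fix j k assume "j \<in> ?K" "k \<in> ?K" "branch j v = branch k v"
    then show "j = k" using branch_in[of j v] branch_in[of k v] piece_unique[of j k "branch j v"] by auto
  qed
  ultimately show ?thesis by (simp add: sum.reindex weight_def)
qed

lemma sum_weights_subset:
  "K \<subseteq> {1..L} \<Longrightarrow> (\<Sum>k\<in>{k\<in>K. v \<in> T ` piece a k}. weight k v) = (\<Sum>k\<in>K. weight k v)"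
  by (intro sum.mono_neutral_left) (auto simp: weight_def intro: finite_subset)

lemma stoch_inv_eq:
  "stoch_inv T L a v z =
    (if v \<in> {0<..<1} \<and> cum L v = 1 then Inf {x \<in> {0..1}. z \<le> inv_cdf T L a x v} else 0)"
proof -
  have tot: "(\<Sum>r\<in>preimages T L a v. 1 / \<bar>deriv T r\<bar>) = cum L v"
    using sum_preimages[of v "\<lambda>_. True"] sum_weights_subset[of "{1..L}" v] by (simp add: cum_def)
  have "v \<in> T ` pieces L a" if "cum L v = 1"
  proof (rule ccontr)
    assume "v \<notin> T ` pieces L a"
    then have "v \<notin> T ` piece a k" if "k \<in> {1..L}" for k
      using that unfolding pieces_def by blast
    then have "cum L v = 0" unfolding cum_def by (intro sum.neutral) (simp add: weight_def)
    with that show False by simp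
  qed
  then show ?thesis unfolding stoch_inv_def tot by auto
qed

lemma inv_cdf_eq:
  "inv_cdf T L a x v = (\<Sum>k\<in>{k\<in>{1..L}. v \<in> T ` piece a k \<and> branch k v \<le> x}. weight k v)"
  unfolding inv_cdf_def by (rule sum_preimages)

lemma inv_cdf_nonneg: "0 \<le> inv_cdf T L a x v"
  unfolding inv_cdf_eq by (intro sum_nonneg weight_nonneg)

text \<open>Before the root in piece \<open>k\<close> the distribution function stays at most \<open>cum (k - 1) v\<close>, and at the root it
  reaches \<open>cum k v\<close>. A level strictly above the first and not above the second is therefore first reached
  at this root.\<close>

lemma stoch_inv_on_stratum:
  assumes k: "k \<in> {1..L}" and z: "z \<in> stratum k v"
  shows "stoch_inv T L a v z = branch k v"
proof -
  note D = stratumD[OF k z]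
  have bk: "branch k v \<in> piece a k" using branch_in[OF k D(7)] .
  have "Inf {x \<in> {0..1}. z \<le> inv_cdf T L a x v} = branch k v"
  proof (rule cInf_eq_minimum)
    have "cum k v = (\<Sum>j\<in>{j\<in>{1..k}. v \<in> T ` piece a j}. weight j v)"
      unfolding cum_def using k by (subst sum_weights_subset) auto
    also have "\<dots> \<le> inv_cdf T L a (branch k v) v"
      unfolding inv_cdf_eq
    proof (rule sum_mono2)
      show "{j\<in>{1..k}. v \<in> T ` piece a j} \<subseteq> {j\<in>{1..L}. v \<in> T ` piece a j \<and> branch j v \<le> branch k v}"
      proof
        fix j assume j: "j \<in> {j\<in>{1..k}. v \<in> T ` piece a j}"
        then have jL: "j \<in> {1..L}" using k by auto
        have "branch j v \<le> branch k v"
        proof (cases "j = k")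
          case False
          then have "j < k" using j by auto
          then show ?thesis using piece_less[OF _ k _ bk, of j "branch j v"] branch_in[OF jL] j by auto
        qed simp
        then show "j \<in> {j\<in>{1..L}. v \<in> T ` piece a j \<and> branch j v \<le> branch k v}" using j jL by auto
      qed
    qed (auto simp: weight_nonneg)
    finally show "branch k v \<in> {x \<in> {0..1}. z \<le> inv_cdf T L a x v}"
      using D(4) bk piece_subset_unit[OF k] by fastforce
  next
    fix x assume x: "x \<in> {x \<in> {0..1}. z \<le> inv_cdf T L a x v}"
    show "branch k v \<le> x"
    proof (rule ccontr)
      assume "\<not> branch k v \<le> x"
      have "inv_cdf T L a x v \<le> cum (k - 1) v"
        unfolding inv_cdf_eq cum_def
      proof (rule sum_mono2)
        show "{j\<in>{1..L}. v \<in> T ` piece a j \<and> branch j v \<le> x} \<subseteq> {1..k - 1}"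
        proof
          fix j assume j: "j \<in> {j\<in>{1..L}. v \<in> T ` piece a j \<and> branch j v \<le> x}"
          then have jL: "j \<in> {1..L}" and bj: "branch j v \<in> piece a j" using branch_in by auto
          have "branch j v < branch k v" using j \<open>\<not> branch k v \<le> x\<close> by auto
          then have "\<not> k < j" "j \<noteq> k" using piece_less[OF _ jL bk bj] by auto
          then show "j \<in> {1..k - 1}" using jL by auto
        qed
      qed (auto simp: weight_nonneg)
      then show False using x D(3) by auto
    qed
  qed
  then show ?thesis using D by (simp add: stoch_inv_eq)
qed

text \<open>For the exceptional \<open>v\<close> both sides are false: the stratum is empty, and the stochastic inverse is 0,
  which lies in no piece. For the others the strata exhaust the levels in the half-open unit interval and
  each sends its levels into its own piece.\<close>

lemma stoch_inv_in_piece_iff: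
  assumes k: "k \<in> {1..L}" and z: "0 < z" "z \<le> 1"
  shows "stoch_inv T L a v z \<in> piece a k \<longleftrightarrow> z \<in> stratum k v"
proof
  assume "z \<in> stratum k v"
  then show "stoch_inv T L a v z \<in> piece a k"
    using stoch_inv_on_stratum[OF k] branch_in[OF k] stratumD(7)[OF k] by simp
next
  assume s: "stoch_inv T L a v z \<in> piece a k"
  have good: "v \<in> {0<..<1}" "cum L v = 1"
    using s piece_subset_unit[OF k] by (auto simp: stoch_inv_eq split: if_splits)
  then obtain j where j: "j \<in> {1..L}" "z \<in> stratum j v" using stratum_exhaust z by blast
  then have "stoch_inv T L a v z \<in> piece a j"
    using stoch_inv_on_stratum branch_in stratumD(7) by simp
  then have "j = k" using piece_unique[OF j(1) k] s by blast
  then show "z \<in> stratum k v" using j by simp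
qed

lemma stratum_measurable [measurable]:
  assumes k: "k \<in> {1..L}"
  shows "Measurable.pred (borel \<Otimes>\<^sub>M borel) (\<lambda>p. snd p \<in> stratum k (fst p))"
proof -
  have [measurable]: "cum k \<in> borel_measurable borel" "cum (k - 1) \<in> borel_measurable borel"
    "cum L \<in> borel_measurable borel" using k by (auto intro!: cum_measurable)
  have eq: "(\<lambda>p. snd p \<in> stratum k (fst p)) = (\<lambda>p::real\<times>real. fst p \<in> {0<..<1} \<and> cum L (fst p) = 1 \<and>
     cum (k - 1) (fst p) < snd p \<and> snd p \<le> cum k (fst p))"
    by (auto simp: stratum_def)
  show ?thesis unfolding eq by measurable
qed

text \<open>On levels in the half-open unit interval the stochastic inverse is a finite sum of branches cut off to
  measurable strata; outside that interval the infimum is over the whole unit interval or over the empty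
  set, hence constant.\<close>

lemma stoch_inv_measurable:
  "(\<lambda>p. stoch_inv T L a (fst p) (snd p)) \<in> borel_measurable (borel \<Otimes>\<^sub>M borel)"
proof -
  have [measurable]: "cum L \<in> borel_measurable borel" by (auto intro!: cum_measurable)
  have *: "stoch_inv T L a v z =
    (if 0 < z \<and> z \<le> 1 then (\<Sum>k\<in>{1..L}. if z \<in> stratum k v then branch k v else 0)
     else if z \<le> 0 then 0 else if v \<in> {0<..<1} \<and> cum L v = 1 then Inf {} else 0)" for v z
  proof -
    consider (bad) "\<not> (v \<in> {0<..<1} \<and> cum L v = 1)"
      | (mid) "v \<in> {0<..<1}" "cum L v = 1" "0 < z" "z \<le> 1"
      | (low) "v \<in> {0<..<1}" "cum L v = 1" "z \<le> 0"
      | (high) "v \<in> {0<..<1}" "cum L v = 1" "1 < z" by fastforce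
    then show ?thesis
    proof cases
      case bad
      then show ?thesis by (auto simp: stoch_inv_eq stratum_def)
    next
      case mid
      then obtain k where k: "k \<in> {1..L}" "z \<in> stratum k v" using stratum_exhaust by blast
      have "(\<Sum>j\<in>{1..L}. if z \<in> stratum j v then branch j v else 0) =
          (\<Sum>j\<in>{1..L}. if j = k then branch j v else 0)"
        using k stratum_unique by (intro sum.cong) auto
      then show ?thesis using k mid stoch_inv_on_stratum[OF k] by simp
    next
      case low
      then have all: "{x \<in> {0..1}. z \<le> inv_cdf T L a x v} = {0..1}"
        using inv_cdf_nonneg[of _ v] by (auto intro: order_trans)
      show ?thesis unfolding stoch_inv_eq all using low by simp
    next
      case high
      have "inv_cdf T L a x v \<le> cum L v" for x
        unfolding inv_cdf_eq cum_def by (intro sum_mono2) (auto simp: weight_nonneg)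
      then have empty: "{x \<in> {0..1}. z \<le> inv_cdf T L a x v} = {}"
        using high by (auto simp: not_le intro: le_less_trans)
      show ?thesis unfolding stoch_inv_eq empty using high by simp
    qed
  qed
  show ?thesis unfolding * by measurable
qed

lemma emeasure_stratum:
  assumes "k \<in> {1..L}" "v \<in> {0<..<1}" "cum L v = 1"
  shows "emeasure unif01 (stratum k v) = ennreal (weight k v)"
proof -
  have "cum k v \<le> 1" using assms cum_mono[of k L v] by auto
  then have "emeasure unif01 {cum (k - 1) v<..cum k v} = ennreal (cum k v - cum (k - 1) v)"
    using cum_mono[of "k - 1" k v] cum_nonneg by (intro emeasure_unif01_Ioc) auto
  then show ?thesis using assms cum_step[of k v] by (simp add: stratum_def)
qed

text \<open>For fixed \<open>v\<close> and uniform level, the root in piece \<open>k\<close> is taken with probability equal to the length of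
  its stratum, which is its weight.\<close>

lemma nn_integral_stoch_inv:
  assumes B: "B \<in> sets borel" and v: "v \<in> {0<..<1}" "cum L v = 1"
  shows "(\<integral>\<^sup>+z. indicator B (stoch_inv T L a v z) \<partial>unif01) =
    (\<Sum>k\<in>{1..L}. ennreal (weight k v) * indicator B (branch k v))"
proof -
  have "(\<integral>\<^sup>+z. indicator B (stoch_inv T L a v z) \<partial>unif01) =
      (\<integral>\<^sup>+z. (\<Sum>k\<in>{1..L}. indicator B (branch k v) * indicator (stratum k v) z) \<partial>unif01)"
  proof (rule nn_integral_cong_AE)
    show "AE z in unif01. indicator B (stoch_inv T L a v z) =
      (\<Sum>k\<in>{1..L}. indicator B (branch k v) * indicator (stratum k v) z :: ennreal)"
      using AE_unif01
    proof eventually_elim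
      case (elim z)
      then obtain k where k: "k \<in> {1..L}" "z \<in> stratum k v"
        using stratum_exhaust[OF v, of z] by auto
      have "(\<Sum>j\<in>{1..L}. indicator B (branch j v) * indicator (stratum j v) z) =
          (\<Sum>j\<in>{1..L}. if j = k then indicator B (branch j v) else (0::ennreal))"
        using k stratum_unique by (intro sum.cong) (auto simp: indicator_def)
      then show ?case using k stoch_inv_on_stratum[OF k] by simp
    qed
  qed
  also have "\<dots> = (\<Sum>k\<in>{1..L}. \<integral>\<^sup>+z. indicator B (branch k v) * indicator (stratum k v) z \<partial>unif01)"
    by (intro nn_integral_sum) (auto simp: stratum_def)
  also have "\<dots> = (\<Sum>k\<in>{1..L}. ennreal (weight k v) * indicator B (branch k v))"
  proof (intro sum.cong refl)
    fix k assume k: "k \<in> {1..L}"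
    have s: "stratum k v \<in> sets unif01" by (simp add: stratum_def)
    show "(\<integral>\<^sup>+z. indicator B (branch k v) * indicator (stratum k v) z \<partial>unif01) =
        ennreal (weight k v) * indicator B (branch k v)"
      unfolding nn_integral_cmult_indicator[OF s] emeasure_stratum[OF k v] by (rule mult.commute)
  qed
  finally show ?thesis .
qed

text \<open>By independence the level may be integrated out first, which leaves the weighted sum over the roots of
  \<open>v\<close>. Integrating this over uniform \<open>v\<close> turns the weights into Lebesgue measure on the pieces.\<close>

lemma distr_stoch_inv:
  assumes "prob_space M"
    and V: "distr M borel V = unif01" and Z: "distr M borel Z = unif01"
    and indep: "prob_space.indep_var M borel V borel Z"
  shows "distr M borel (\<lambda>w. stoch_inv T L a (V w) (Z w)) = unif01"
proof (rule measure_eqI)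
  interpret M: prob_space M by fact
  interpret U: prob_space unif01 by (rule prob_space_unif01)
  note ind = indep[unfolded M.indep_var_distribution_eq]
  have [measurable]: "V \<in> borel_measurable M" "Z \<in> borel_measurable M" using ind by auto
  let ?S = "\<lambda>p. stoch_inv T L a (fst p) (snd p)"
  note [measurable] = stoch_inv_measurable
  fix B assume "B \<in> sets (distr M borel (\<lambda>w. stoch_inv T L a (V w) (Z w)))"
  then have B [measurable]: "B \<in> sets borel" by simp
  have meas: "(\<lambda>w. stoch_inv T L a (V w) (Z w)) \<in> borel_measurable M"
    using measurable_compose[OF measurable_Pair stoch_inv_measurable, of V M Z] by simp
  have "emeasure (distr M borel (\<lambda>w. stoch_inv T L a (V w) (Z w))) B =
      (\<integral>\<^sup>+u. indicator B u \<partial>distr M borel (\<lambda>w. stoch_inv T L a (V w) (Z w)))"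
    by simp
  also have "\<dots> = (\<integral>\<^sup>+w. indicator B (?S (V w, Z w)) \<partial>M)"
    by (subst nn_integral_distr[OF meas]) simp_all
  also have "\<dots> = (\<integral>\<^sup>+p. indicator B (?S p) \<partial>distr M (borel \<Otimes>\<^sub>M borel) (\<lambda>w. (V w, Z w)))"
    by (subst nn_integral_distr) auto
  also have "distr M (borel \<Otimes>\<^sub>M borel) (\<lambda>w. (V w, Z w)) = unif01 \<Otimes>\<^sub>M unif01"
    using ind V Z by simp
  also have "(\<integral>\<^sup>+p. indicator B (?S p) \<partial>(unif01 \<Otimes>\<^sub>M unif01)) =
      (\<integral>\<^sup>+v. \<integral>\<^sup>+z. indicator B (stoch_inv T L a v z) \<partial>unif01 \<partial>unif01)"
  proof -
    have "(\<lambda>p. indicator B (?S p) :: ennreal) \<in> borel_measurable (borel \<Otimes>\<^sub>M borel)" by measurable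
    then have "(\<lambda>p. indicator B (?S p) :: ennreal) \<in> borel_measurable (unif01 \<Otimes>\<^sub>M unif01)"
      by (subst measurable_cong_sets[OF sets_pair_measure_cong refl]) auto
    from U.nn_integral_fst[OF this] show ?thesis by simp
  qed
  also have "\<dots> = (\<integral>\<^sup>+v. (\<Sum>k\<in>{1..L}. ennreal (weight k v) * indicator B (branch k v)) \<partial>unif01)"
  proof (rule nn_integral_cong_AE)
    have "AE v in unif01. v \<in> {0<..<1} \<longrightarrow> cum L v = 1"
      using AE_cum_eq_1 by (intro AE_uniform_measureI) (auto elim!: eventually_mono)
    then show "AE v in unif01. (\<integral>\<^sup>+z. indicator B (stoch_inv T L a v z) \<partial>unif01) =
       (\<Sum>k\<in>{1..L}. ennreal (weight k v) * indicator B (branch k v))"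
      using AE_unif01 by eventually_elim (intro nn_integral_stoch_inv[OF B], auto)
  qed
  also have "\<dots> = (\<integral>\<^sup>+v. (\<Sum>k\<in>{1..L}. ennreal (weight k v) * indicator B (branch k v)) \<partial>lborel)"
  proof (subst nn_integral_unif01)
    show "(\<integral>\<^sup>+v. (\<Sum>k\<in>{1..L}. ennreal (weight k v) * indicator B (branch k v)) *
        indicator {0<..<1} v \<partial>lborel) =
      (\<integral>\<^sup>+v. (\<Sum>k\<in>{1..L}. ennreal (weight k v) * indicator B (branch k v)) \<partial>lborel)"
    proof (intro nn_integral_cong)
      fix v
      \<comment> \<open>no roots exist for values outside the open unit interval\<close>
      have "weight k v = 0" if "v \<notin> {0<..<1}" "k \<in> {1..L}" for k
        using that T_image_subset[of k] by (auto simp: weight_def)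
      then show "(\<Sum>k\<in>{1..L}. ennreal (weight k v) * indicator B (branch k v)) * indicator {0<..<1} v =
        (\<Sum>k\<in>{1..L}. ennreal (weight k v) * indicator B (branch k v))"
        by (cases "v \<in> {0<..<1}") auto
    qed
  qed (intro borel_measurable_sum, measurable)
  also have "\<dots> = (\<Sum>k\<in>{1..L}. \<integral>\<^sup>+v. ennreal (weight k v) * indicator B (branch k v) \<partial>lborel)"
    by (intro nn_integral_sum) measurable
  also have "\<dots> = (\<Sum>k\<in>{1..L}. emeasure lborel (B \<inter> piece a k))"
  proof (intro sum.cong refl)
    fix k assume k: "k \<in> {1..L}"
    have "(\<integral>\<^sup>+v. ennreal (weight k v) * indicator B (branch k v) \<partial>lborel) =
        (\<integral>\<^sup>+u. indicator (piece a k) u * indicator B u \<partial>lborel)"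
      using nn_integral_weight[OF k, of "indicator B"] by simp
    also have "\<dots> = (\<integral>\<^sup>+u. indicator (B \<inter> piece a k) u \<partial>lborel)"
      by (intro nn_integral_cong) (auto simp: indicator_def)
    also have "\<dots> = emeasure lborel (B \<inter> piece a k)"
      using B by (intro nn_integral_indicator) (simp add: piece_def)
    finally show "(\<integral>\<^sup>+v. ennreal (weight k v) * indicator B (branch k v) \<partial>lborel) =
        emeasure lborel (B \<inter> piece a k)" .
  qed
  also have "\<dots> = emeasure lborel (B \<inter> {0<..<1})" by (rule sum_over_pieces[OF B])
  also have "\<dots> = emeasure unif01 B"
    by (subst emeasure_uniform_measure) (auto simp: Int_commute divide_ennreal_def)
  finally show "emeasure (distr M borel (\<lambda>w. stoch_inv T L a (V w) (Z w))) B = emeasure unif01 B" .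
qed simp

end


section \<open>Products of push-forwards and disintegration\<close>

lemma borel_measurable_vec_nth [measurable (raw)]:
  fixes f :: "'a \<Rightarrow> real ^ 'd::finite"
  assumes [measurable]: "f \<in> borel_measurable M"
  shows "(\<lambda>x. f x $ i) \<in> borel_measurable M"
proof -
  have "(\<lambda>x. f x \<bullet> axis i 1) \<in> borel_measurable M" by measurable
  then show ?thesis by (simp add: cart_eq_inner_axis)
qed

lemma borel_measurable_vec_lambda [measurable (raw)]:
  fixes f :: "'a \<Rightarrow> 'd::finite \<Rightarrow> real"
  assumes "\<And>i. (\<lambda>x. f x i) \<in> borel_measurable M"
  shows "(\<lambda>x. \<chi> i. f x i) \<in> borel_measurable M"
proof -
  have "(\<chi> i. f x i) = (\<Sum>i\<in>UNIV. f x i *\<^sub>R axis i 1)" for x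
    by (simp add: vec_eq_iff axis_def if_distrib[of "\<lambda>y. _ * y"] cong: if_cong)
  moreover have "(\<lambda>x. \<Sum>i\<in>UNIV. f x i *\<^sub>R (axis i 1 :: real ^ 'd)) \<in> borel_measurable M"
    using assms by (intro borel_measurable_sum borel_measurable_scaleR) auto
  ultimately show ?thesis by simp
qed

lemma prod_indicator_eq:
  "(\<Prod>i\<in>UNIV. indicator (A i) (x i)) = (if \<forall>i::'d::finite. x i \<in> A i then 1 else 0 :: ennreal)"
  by (auto intro!: prod.neutral prod_zero indicator_simps(2))

lemma nn_integral_prod_vec:
  fixes f :: "'d::finite \<Rightarrow> real \<Rightarrow> ennreal"
  assumes [measurable]: "\<And>i. f i \<in> borel_measurable borel"
  shows "(\<integral>\<^sup>+x. (\<Prod>i\<in>UNIV. f i (x $ i)) \<partial>(lborel :: (real^'d) measure)) = (\<Prod>i\<in>UNIV. \<integral>\<^sup>+x. f i x \<partial>lborel)"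
proof -
  let ?e = "\<lambda>i::'d. axis i (1::real)"
  have inj: "inj ?e" by (auto simp: inj_def axis_eq_axis)
  have Basis: "(Basis :: (real^'d) set) = range ?e" by (auto simp: Basis_vec_def)
  define g where "g b = f (the_inv ?e b)" for b
  have g: "g (?e i) = f i" for i unfolding g_def by (simp add: the_inv_f_f[OF inj])
  have m: "g b \<in> borel_measurable borel" for b unfolding g_def by simp
  have "(\<integral>\<^sup>+x. (\<Prod>b\<in>Basis. g b (x \<bullet> b)) \<partial>(lborel :: (real^'d) measure)) = (\<Prod>b\<in>Basis. \<integral>\<^sup>+x. g b x \<partial>lborel)"
    using m by (intro nn_integral_lborel_prod) auto
  then show ?thesis
    unfolding Basis by (simp add: prod.reindex[OF inj] g cart_eq_inner_axis[symmetric])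
qed

text \<open>Coordinatewise push-forwards commute with products: by Fubini both measures give a box the product of
  the one-dimensional measures of its sides. The boxes form an intersection-stable generator, and
  finiteness of the factors makes the measures finite on it.\<close>

lemma density_prod_eq_distr:
  fixes f g :: "'d::finite \<Rightarrow> real \<Rightarrow> ennreal" and r :: "'d \<Rightarrow> real \<Rightarrow> real"
  assumes f [measurable]: "\<And>i. f i \<in> borel_measurable borel"
    and g [measurable]: "\<And>i. g i \<in> borel_measurable borel"
    and r [measurable]: "\<And>i. r i \<in> borel_measurable borel"
    and fin: "\<And>i. (\<integral>\<^sup>+x. f i x \<partial>lborel) \<noteq> \<infinity>"
    and eq: "\<And>i. density lborel (f i) = distr (density lborel (g i)) borel (r i)"
  shows "density lborel (\<lambda>u::real^'d. \<Prod>i\<in>UNIV. f i (u $ i)) =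
    distr (density lborel (\<lambda>v::real^'d. \<Prod>i\<in>UNIV. g i (v $ i))) borel (\<lambda>v. \<chi> i. r i (v $ i))"
    (is "?F = ?G")
proof (rule measure_eqI_generator_eq)
  let ?E = "range (\<lambda>(a, b). box a b::(real^'d) set)"
  show "Int_stable ?E"
    by (auto simp: Int_stable_def box_Int_box)
  show "?E \<subseteq> Pow UNIV" "sets ?F = sigma_sets UNIV ?E" "sets ?G = sigma_sets UNIV ?E"
    by (simp_all add: borel_eq_box)
  let ?A = "\<lambda>n::nat. box (- (real n *\<^sub>R One)) (real n *\<^sub>R One) :: (real^'d) set"
  show "range ?A \<subseteq> ?E" "(\<Union>i. ?A i) = UNIV"
    unfolding UN_box_eq_UNIV by auto
  show "emeasure ?F (?A n) \<noteq> \<infinity>" for n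
  proof -
    have "emeasure ?F (?A n) \<le> emeasure ?F UNIV" by (intro emeasure_mono) auto
    also have "\<dots> = (\<Prod>i\<in>UNIV. \<integral>\<^sup>+x. f i x \<partial>lborel)"
      by (subst emeasure_density) (auto simp: nn_integral_prod_vec)
    also have "\<dots> < \<infinity>" using fin by (simp add: less_top[symmetric] ennreal_prod_eq_top)
    finally show ?thesis by simp
  qed
  fix X assume "X \<in> ?E"
  then obtain a b :: "real^'d" where X: "X = box a b" by auto
  let ?I = "\<lambda>i. {a $ i<..<b $ i}"
  have ind: "indicator X u = (\<Prod>i\<in>UNIV. indicator (?I i) (u $ i) :: ennreal)" for u
    unfolding prod_indicator_eq X by (auto simp: indicator_def mem_box_cart)
  have "emeasure ?F X = (\<integral>\<^sup>+u. (\<Prod>i\<in>UNIV. f i (u $ i) * indicator (?I i) (u $ i)) \<partial>(lborel :: (real^'d) measure))"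
    unfolding prod.distrib ind[symmetric] by (subst emeasure_density) (auto simp: X)
  also have "\<dots> = (\<Prod>i\<in>UNIV. emeasure (density lborel (f i)) (?I i))"
    by (subst nn_integral_prod_vec) (auto simp: emeasure_density)
  also have "\<dots> = (\<Prod>i\<in>UNIV. \<integral>\<^sup>+v. g i v * indicator (?I i) (r i v) \<partial>lborel)"
  proof (intro prod.cong refl)
    fix i
    have "emeasure (density lborel (f i)) (?I i) =
        (\<integral>\<^sup>+u. indicator (?I i) u \<partial>distr (density lborel (g i)) borel (r i))"
      unfolding eq by simp
    also have "\<dots> = (\<integral>\<^sup>+v. g i v * indicator (?I i) (r i v) \<partial>lborel)"
      by (subst nn_integral_distr, simp_all) (subst nn_integral_density, simp_all)
    finally show "emeasure (density lborel (f i)) (?I i) = \<dots>" .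
  qed
  also have "\<dots> = (\<integral>\<^sup>+v. (\<Prod>i\<in>UNIV. g i (v $ i) * indicator (?I i) (r i (v $ i))) \<partial>(lborel :: (real^'d) measure))"
    by (rule nn_integral_prod_vec[symmetric]) measurable
  also have "\<dots> = (\<integral>\<^sup>+v. (\<Prod>i\<in>UNIV. g i (v $ i)) * indicator X (\<chi> i. r i (v $ i)) \<partial>(lborel :: (real^'d) measure))"
    by (simp add: prod.distrib ind)
  also have "\<dots> = (\<integral>\<^sup>+u. indicator X u \<partial>?G)"
    by (subst nn_integral_distr, simp_all add: X, measurable) (subst nn_integral_density, measurable)
  also have "\<dots> = emeasure ?G X" by (intro nn_integral_indicator) (simp add: X)
  finally show "emeasure ?F X = emeasure ?G X" .
qed

lemma ocube_borel [measurable]: "(ocube :: (real^'d::finite) set) \<in> sets borel"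
  by measurable

lemma Int_ocube_sets:
  fixes D :: "((real ^ 'd::finite) \<times> (real ^ 'd)) set"
  assumes "D \<in> sets (borel \<Otimes>\<^sub>M borel)"
  shows "D \<inter> ocube \<times> ocube \<in> sets (restrict_space borel ocube \<Otimes>\<^sub>M restrict_space borel ocube)"
proof -
  let ?B = "restrict_space borel (ocube :: (real^'d) set)"
  have "(\<lambda>p. p) \<in> measurable (?B \<Otimes>\<^sub>M ?B) (borel \<Otimes>\<^sub>M borel)"
    unfolding measurable_pair_iff
    by (auto simp: comp_def intro!: measurable_compose[OF measurable_fst]
        measurable_compose[OF measurable_snd] measurable_restrict_space1)
  from measurable_sets[OF this assms] show ?thesis
    by (simp add: space_pair_measure space_restrict_space)
qed

text \<open>The definition of a regular conditional distribution fixes the joint law on rectangles only. The joint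
  law and the composition of the law of \<open>V\<close> with the kernel are finite measures on the product of the
  open cube with itself, and rectangles form an intersection-stable generator, so the two agree on all
  measurable sets. This is needed because the event that \<open>U\<close> falls into a cell is not a rectangle.\<close>

lemma reg_cond_dist_emeasure:
  fixes V Z :: "'w \<Rightarrow> real ^ 'd::finite"
  assumes "prob_space M"
    and V [measurable]: "V \<in> borel_measurable M" and Z [measurable]: "Z \<in> borel_measurable M"
    and V_ae: "AE w in M. V w \<in> ocube" and Z_ae: "AE w in M. Z w \<in> ocube"
    and \<kappa>: "reg_cond_dist M Z V \<kappa>"
    and D [measurable]: "D \<in> sets (borel \<Otimes>\<^sub>M borel)"
  shows "emeasure M {w \<in> space M. (V w, Z w) \<in> D} =
    (\<integral>\<^sup>+v. emeasure (\<kappa> v) {z \<in> ocube. (v, z) \<in> D} * indicator ocube v \<partial>distr M borel V)"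
proof -
  interpret M: prob_space M by fact
  let ?B = "restrict_space borel (ocube :: (real^'d) set)"
  let ?G = "{w \<in> space M. V w \<in> ocube \<and> Z w \<in> ocube}"
  let ?P = "restrict_space (distr M borel V) ocube"
  \<comment> \<open>attaching the point v to the kernel makes its composition with the law of V the joint law of V and Z\<close>
  let ?pair = "\<lambda>v. distr (\<kappa> v) (?B \<Otimes>\<^sub>M ?B) (Pair v)"
  let ?joint = "distr (restrict_space M ?G) (?B \<Otimes>\<^sub>M ?B) (\<lambda>w. (V w, Z w))"
  have setsB: "A \<in> sets ?B \<longleftrightarrow> A \<in> sets borel \<and> A \<subseteq> ocube" for A
    by (subst sets_restrict_space_iff) auto
  have spB: "space ?B = ocube" by (simp add: space_restrict_space)
  have setsP: "sets ?P = sets ?B" by (simp add: sets_restrict_space)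
  have spP: "space ?P = ocube" by (simp add: space_restrict_space)
  have G [measurable]: "?G \<in> sets M" by measurable
  have kern: "\<kappa> \<in> measurable ?B (subprob_algebra ?B)"
    using \<kappa> by (auto simp: reg_cond_dist_def intro: measurable_prob_algebraD)
  have setsK: "sets (\<kappa> v) = sets ?B" "space (\<kappa> v) = ocube" if "v \<in> ocube" for v
    using subprob_measurableD[OF kern, of v] that spB by auto
  have rect: "emeasure M {w \<in> space M. V w \<in> A \<and> Z w \<in> B} =
      (\<integral>\<^sup>+v\<in>A. emeasure (\<kappa> v) B \<partial>distr M borel V)" if "A \<in> sets ?B" "B \<in> sets ?B" for A B
    using \<kappa> that unfolding reg_cond_dist_def setsB by blast
  have Pair_m: "Pair v \<in> measurable ?B (?B \<Otimes>\<^sub>M ?B)" if "v \<in> ocube" for v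
    using that spB by (intro measurable_Pair1') simp
  have pair: "?pair \<in> measurable ?P (subprob_algebra (?B \<Otimes>\<^sub>M ?B))"
  proof -
    have "?pair \<in> measurable ?B (subprob_algebra (?B \<Otimes>\<^sub>M ?B))"
      by (rule measurable_distr2[OF _ kern]) simp
    then show ?thesis by (subst measurable_cong_sets[OF setsP refl])
  qed
  have ne: "space ?P \<noteq> {}"
  proof -
    have "(\<chi> i. 1 / 2) \<in> (ocube :: (real^'d) set)" by simp
    then show ?thesis unfolding spP by blast
  qed
  have em_pair: "emeasure (?pair v) X = emeasure (\<kappa> v) {z \<in> ocube. (v, z) \<in> X}"
    if v: "v \<in> ocube" and X: "X \<in> sets (?B \<Otimes>\<^sub>M ?B)" for v X
  proof -
    have m: "Pair v \<in> measurable (\<kappa> v) (?B \<Otimes>\<^sub>M ?B)"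
      using Pair_m[OF v] by (subst measurable_cong_sets[OF setsK(1)[OF v] refl])
    have "Pair v -` X \<inter> space (\<kappa> v) = {z \<in> ocube. (v, z) \<in> X}"
      unfolding setsK(2)[OF v] by blast
    then show ?thesis by (simp only: emeasure_distr[OF m X])
  qed
  have em_bind: "emeasure (?P \<bind> ?pair) X =
      (\<integral>\<^sup>+v. emeasure (\<kappa> v) {z \<in> ocube. (v, z) \<in> X} * indicator ocube v \<partial>distr M borel V)"
    if X: "X \<in> sets (?B \<Otimes>\<^sub>M ?B)" for X
  proof -
    have "emeasure (?P \<bind> ?pair) X = (\<integral>\<^sup>+v. emeasure (?pair v) X \<partial>?P)"
      by (rule emeasure_bind[OF ne pair X])
    also have "\<dots> = (\<integral>\<^sup>+v. emeasure (\<kappa> v) {z \<in> ocube. (v, z) \<in> X} \<partial>?P)"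
      using X by (intro nn_integral_cong em_pair) (simp_all add: spP)
    finally show ?thesis by (subst (asm) nn_integral_restrict_space) simp_all
  qed
  have VZ: "(\<lambda>w. (V w, Z w)) \<in> measurable (restrict_space M ?G) (?B \<Otimes>\<^sub>M ?B)"
    by (intro measurable_Pair measurable_restrict_space2 measurable_restrict_space1 V Z)
       (auto simp: space_restrict_space)
  have em_joint: "emeasure ?joint X = emeasure M {w \<in> ?G. (V w, Z w) \<in> X}"
    if X: "X \<in> sets (?B \<Otimes>\<^sub>M ?B)" for X
  proof -
    have "emeasure ?joint X = emeasure (restrict_space M ?G) {w \<in> ?G. (V w, Z w) \<in> X}"
    proof -
      have "(\<lambda>w. (V w, Z w)) -` X \<inter> space (restrict_space M ?G) = {w \<in> ?G. (V w, Z w) \<in> X}"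
        unfolding space_restrict_space by blast
      then show ?thesis by (simp only: emeasure_distr[OF VZ X])
    qed
    also have "\<dots> = emeasure M {w \<in> ?G. (V w, Z w) \<in> X}"
      using G by (intro emeasure_restrict_space) auto
    finally show ?thesis .
  qed
  have eq: "?joint = ?P \<bind> ?pair"
  proof (rule measure_eqI_generator_eq[OF Int_stable_pair_measure_generator[of ?B ?B]])
    let ?R = "{a \<times> b |a b. a \<in> sets ?B \<and> b \<in> sets ?B}"
    show "?R \<subseteq> Pow (ocube \<times> ocube)" using setsB by blast
    show "sets ?joint = sigma_sets (ocube \<times> ocube) ?R"
      unfolding sets_distr sets_pair_measure spB ..
    show "sets (?P \<bind> ?pair) = sigma_sets (ocube \<times> ocube) ?R"
      using sets_bind[OF sets_kernel[OF pair] ne] unfolding sets_pair_measure spB by simp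
    show "range (\<lambda>_::nat. ocube \<times> ocube) \<subseteq> ?R"
      using sets.top[of ?B] unfolding spB by blast
    show "(\<Union>i::nat. ocube \<times> ocube) = ocube \<times> ocube" by simp
    show "emeasure ?joint (ocube \<times> ocube) \<noteq> \<infinity>"
    proof -
      have "ocube \<times> ocube \<in> sets (?B \<Otimes>\<^sub>M ?B)"
        using sets.top[of ?B] unfolding spB by (intro pair_measureI)
      from em_joint[OF this] show ?thesis by (simp only: M.emeasure_finite infinity_ennreal_def not_False_eq_True)
    qed
    fix X assume "X \<in> ?R"
    then obtain A B where X: "X = A \<times> B" and AB: "A \<in> sets ?B" "B \<in> sets ?B" by blast
    then have Xs: "X \<in> sets (?B \<Otimes>\<^sub>M ?B)" by simp
    have sub: "A \<subseteq> ocube" "B \<subseteq> ocube" using AB setsB by blast+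
    have "emeasure ?joint X = emeasure M {w \<in> space M. V w \<in> A \<and> Z w \<in> B}"
      unfolding em_joint[OF Xs] using sub by (intro arg_cong[where f="emeasure M"]) (auto simp: X)
    also have "\<dots> = (\<integral>\<^sup>+v\<in>A. emeasure (\<kappa> v) B \<partial>distr M borel V)" by (rule rect[OF AB])
    also have "\<dots> = emeasure (?P \<bind> ?pair) X"
      unfolding em_bind[OF Xs]
    proof (intro nn_integral_cong)
      fix v
      have "{z \<in> ocube. (v, z) \<in> X} = (if v \<in> A then B else {})" using sub by (auto simp: X)
      then show "emeasure (\<kappa> v) B * indicator A v =
          emeasure (\<kappa> v) {z \<in> ocube. (v, z) \<in> X} * indicator ocube v"
        using sub by (auto simp: indicator_def)
    qed
    finally show "emeasure ?joint X = emeasure (?P \<bind> ?pair) X" .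
  qed
  let ?X = "D \<inter> (ocube \<times> ocube)"
  have X: "?X \<in> sets (?B \<Otimes>\<^sub>M ?B)" by (rule Int_ocube_sets[OF D])
  have "emeasure M {w \<in> space M. (V w, Z w) \<in> D} = emeasure M {w \<in> ?G. (V w, Z w) \<in> ?X}"
  proof (rule emeasure_eq_AE)
    show "AE w in M. w \<in> {w \<in> space M. (V w, Z w) \<in> D} \<longleftrightarrow> w \<in> {w \<in> ?G. (V w, Z w) \<in> ?X}"
      using V_ae Z_ae by eventually_elim auto
    show "{w \<in> space M. (V w, Z w) \<in> D} \<in> sets M" by measurable
    have "{w \<in> ?G. (V w, Z w) \<in> ?X} = ?G \<inter> {w \<in> space M. (V w, Z w) \<in> D}" by auto
    then show "{w \<in> ?G. (V w, Z w) \<in> ?X} \<in> sets M" by simp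
  qed
  also have "\<dots> = emeasure (?P \<bind> ?pair) ?X" by (simp only: em_joint[OF X, symmetric] eq)
  also have "\<dots> = (\<integral>\<^sup>+v. emeasure (\<kappa> v) {z \<in> ocube. (v, z) \<in> D} * indicator ocube v \<partial>distr M borel V)"
    unfolding em_bind[OF X]
    by (intro nn_integral_cong) (auto simp: indicator_def intro!: arg_cong[where f="emeasure (\<kappa> _)"])
  finally show ?thesis .
qed


section \<open>Cells of the product partition\<close>

locale udp_partitions =
  fixes T :: "'d::finite \<Rightarrow> real \<Rightarrow> real" and L :: "'d \<Rightarrow> nat" and a :: "'d \<Rightarrow> nat \<Rightarrow> real"
  assumes component: "\<And>i. udp_partition (T i) (L i) (a i)"
begin

sublocale comp: udp_partition "T i" "L i" "a i" for i
  by (rule component)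

abbreviation cells :: "('d \<Rightarrow> nat) set" where
  "cells \<equiv> \<Pi>\<^sub>E i\<in>UNIV. {1..L i}"

text \<open>A cell is a product of pieces, one per coordinate. The following maps and sets are the coordinatewise
  versions of those for a single transformation.\<close>

definition cell :: "('d \<Rightarrow> nat) \<Rightarrow> (real ^ 'd) set" where
  "cell l = {u. \<forall>i. u $ i \<in> piece (a i) (l i)}"

definition cell_image :: "('d \<Rightarrow> nat) \<Rightarrow> (real ^ 'd) set" where
  "cell_image l = {v. \<forall>i. v $ i \<in> T i ` piece (a i) (l i)}"

definition cell_inv :: "('d \<Rightarrow> nat) \<Rightarrow> real ^ 'd \<Rightarrow> real ^ 'd" where
  "cell_inv l v = (\<chi> i. comp.branch i (l i) (v $ i))"

text \<open>For levels \<open>z\<close> in the open unit cube these are the pairs \<open>(v, z)\<close> whose vector of stochastic inverses lies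
  in the cell \<open>l\<close>; strata are used because they make the set visibly measurable.\<close>

definition allocated :: "('d \<Rightarrow> nat) \<Rightarrow> ((real ^ 'd) \<times> (real ^ 'd)) set" where
  "allocated l = {p. \<forall>i. snd p $ i \<in> comp.stratum i (l i) (fst p $ i)}"

definition stoch_inv_vec :: "real ^ 'd \<Rightarrow> real ^ 'd \<Rightarrow> real ^ 'd" where
  "stoch_inv_vec v z = (\<chi> i. stoch_inv (T i) (L i) (a i) (v $ i) (z $ i))"

definition jacobian :: "real ^ 'd \<Rightarrow> real" where
  "jacobian u = (\<Prod>i\<in>UNIV. \<bar>deriv (T i) (u $ i)\<bar>)"

lemma cellsD: "l \<in> cells \<Longrightarrow> l i \<in> {1..L i}" by (auto simp: PiE_iff)

lemma finite_cells: "finite cells" by (intro finite_PiE) auto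

lemma jacobian_nonneg: "0 \<le> jacobian u" by (simp add: jacobian_def prod_nonneg)

lemma cell_inv_measurable [measurable]:
  assumes l: "l \<in> cells" shows "cell_inv l \<in> borel_measurable borel"
proof -
  have [measurable]: "comp.branch i (l i) \<in> borel_measurable borel" for i
    by (rule comp.branch_measurable[OF cellsD[OF l]])
  show ?thesis unfolding cell_inv_def by measurable
qed

lemma map_vec_cell_inv:
  assumes l: "l \<in> cells" and v: "v \<in> cell_image l"
  shows "map_vec T (cell_inv l v) = v"
proof -
  have "T i (comp.branch i (l i) (v $ i)) = v $ i" for i
    using v by (intro comp.T_branch cellsD[OF l]) (simp add: cell_image_def)
  then show ?thesis by (simp add: map_vec_def cell_inv_def vec_eq_iff)
qed

lemma cell_inv_in_cell:
  assumes l: "l \<in> cells" and v: "v \<in> cell_image l"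
  shows "cell_inv l v \<in> cell l"
proof -
  have "comp.branch i (l i) (v $ i) \<in> piece (a i) (l i)" for i
    using v by (intro comp.branch_in cellsD[OF l]) (simp add: cell_image_def)
  then show ?thesis by (simp add: cell_def cell_inv_def)
qed

text \<open>The coordinatewise map, cut off outside the cell. On its pieces each \<open>T\<^sub>i\<close> is continuous, so the cut-off
  version is Borel on the whole space, whereas nothing is known of \<open>T\<^sub>i\<close> outside the unit interval.\<close>

definition cell_map :: "('d \<Rightarrow> nat) \<Rightarrow> real ^ 'd \<Rightarrow> real ^ 'd" where
  "cell_map l u = (\<chi> i. indicator (piece (a i) (l i)) (u $ i) * T i (u $ i))"

lemma cell_map_eq: "u \<in> cell l \<Longrightarrow> cell_map l u = map_vec T u"
  by (simp add: cell_map_def map_vec_def cell_def)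

lemma cell_map_measurable [measurable]:
  assumes l: "l \<in> cells" shows "cell_map l \<in> borel_measurable borel"
proof -
  have [measurable]: "(\<lambda>u. indicator (piece (a i) (l i)) u * T i u) \<in> borel_measurable borel" for i
  proof -
    have "(\<lambda>u. indicator (piece (a i) (l i)) u *\<^sub>R T i u) \<in> borel_measurable borel"
      by (intro borel_measurable_continuous_on_indicator comp.T_continuous cellsD[OF l])
         (simp add: piece_def)
    then show ?thesis by simp
  qed
  show ?thesis unfolding cell_map_def by measurable
qed

lemma cell_jacobian_eq:
  "(\<Prod>i\<in>UNIV. ennreal (indicator (piece (a i) (l i)) (u $ i) * \<bar>deriv (T i) (u $ i)\<bar>)) =
    indicator (cell l) u * ennreal (jacobian u)"
proof (cases "u \<in> cell l")
  case True
  then show ?thesis by (simp add: cell_def jacobian_def prod_ennreal)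
next
  case False
  then obtain i where "u $ i \<notin> piece (a i) (l i)" by (auto simp: cell_def)
  then show ?thesis using False by (auto intro!: prod_zero bexI[of _ i] exI[of _ i])
qed

lemma cell_jacobian_measurable:
  assumes l: "l \<in> cells"
  shows "(\<lambda>u. indicator (cell l) u * ennreal (jacobian u)) \<in> borel_measurable borel"
proof -
  have [measurable]: "(\<lambda>u. indicator (piece (a i) (l i)) u * \<bar>deriv (T i) u\<bar>) \<in> borel_measurable borel" for i
    by (rule comp.abs_deriv_measurable[OF cellsD[OF l]])
  show ?thesis unfolding cell_jacobian_eq[symmetric] by measurable
qed

lemma cell_density_eq_distr:
  assumes l: "l \<in> cells"
  shows "density lborel (\<lambda>u. indicator (cell l) u * ennreal (jacobian u)) =
    distr (density lborel (indicator (cell_image l))) borel (cell_inv l)"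
proof -
  have "density lborel (\<lambda>u. \<Prod>i\<in>UNIV. ennreal (indicator (piece (a i) (l i)) (u $ i) * \<bar>deriv (T i) (u $ i)\<bar>)) =
    distr (density lborel (\<lambda>v. \<Prod>i\<in>UNIV. indicator (T i ` piece (a i) (l i)) (v $ i))) borel
      (\<lambda>v. \<chi> i. comp.branch i (l i) (v $ i))"
  proof (rule density_prod_eq_distr)
    fix i
    note li = cellsD[OF l, of i]
    show "(\<lambda>u. ennreal (indicator (piece (a i) (l i)) u * \<bar>deriv (T i) u\<bar>)) \<in> borel_measurable borel"
      using comp.abs_deriv_measurable[OF li] by (rule measurable_compose) simp
    show "indicator (T i ` piece (a i) (l i)) \<in> borel_measurable borel"
      using comp.T_image_borel[OF li] by simp
    show "comp.branch i (l i) \<in> borel_measurable borel" by (rule comp.branch_measurable[OF li])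
    show "density lborel (\<lambda>u. ennreal (indicator (piece (a i) (l i)) u * \<bar>deriv (T i) u\<bar>)) =
      distr (density lborel (indicator (T i ` piece (a i) (l i)))) borel (comp.branch i (l i))"
      by (rule comp.density_deriv_eq_distr_branch[OF li])
    have "(\<integral>\<^sup>+u. ennreal (indicator (piece (a i) (l i)) u * \<bar>deriv (T i) u\<bar>) \<partial>lborel) =
      emeasure lborel (T i ` piece (a i) (l i))"
      using comp.emeasure_T_image[OF li, of UNIV] by simp
    also have "\<dots> \<le> emeasure lborel {0..1::real}"
      using comp.T_image_subset[OF li] by (intro emeasure_mono) (auto simp: subset_eq less_imp_le)
    finally show "(\<integral>\<^sup>+u. ennreal (indicator (piece (a i) (l i)) u * \<bar>deriv (T i) u\<bar>) \<partial>lborel) \<noteq> \<infinity>"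
      by (auto simp: top_unique)
  qed
  moreover have "(\<Prod>i\<in>UNIV. indicator (T i ` piece (a i) (l i)) (v $ i)) = (indicator (cell_image l) v :: ennreal)" for v
    unfolding prod_indicator_eq by (simp add: cell_image_def indicator_def)
  ultimately show ?thesis unfolding cell_jacobian_eq cell_inv_def[abs_def] by simp
qed

lemma cell_image_borel [measurable]:
  assumes l: "l \<in> cells" shows "cell_image l \<in> sets borel"
proof -
  have [measurable]: "T i ` piece (a i) (l i) \<in> sets borel" for i
    by (rule comp.T_image_borel[OF cellsD[OF l]])
  show ?thesis unfolding cell_image_def by measurable
qed

text \<open>Change of variables along the coordinatewise map on a cell. The functions of interest combine an
  indicator in the variable \<open>u\<close> with a function of the image point \<open>v\<close>, hence the two factors.\<close>

lemma nn_integral_cell: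
  fixes g :: "real ^ 'd \<Rightarrow> ennreal"
  assumes l: "l \<in> cells" and E [measurable]: "E \<in> sets borel" and g [measurable]: "g \<in> borel_measurable borel"
  shows "(\<integral>\<^sup>+v. indicator (cell_image l) v * (indicator E (cell_inv l v) * g v) \<partial>lborel) =
    (\<integral>\<^sup>+u. indicator (cell l) u * ennreal (jacobian u) * (indicator E u * g (map_vec T u)) \<partial>lborel)"
proof -
  note [measurable] = cell_inv_measurable[OF l] cell_map_measurable[OF l] cell_jacobian_measurable[OF l]
    cell_image_borel[OF l]
  let ?h = "\<lambda>u. indicator E u * g (cell_map l u)"
  have "(\<integral>\<^sup>+v. indicator (cell_image l) v * (indicator E (cell_inv l v) * g v) \<partial>lborel) =
      (\<integral>\<^sup>+v. indicator (cell_image l) v * ?h (cell_inv l v) \<partial>lborel)"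
    using map_vec_cell_inv[OF l] cell_map_eq[OF cell_inv_in_cell[OF l]]
    by (intro nn_integral_cong) (simp add: indicator_def)
  also have "\<dots> = integral\<^sup>N (distr (density lborel (indicator (cell_image l))) borel (cell_inv l)) ?h"
    by (simp add: nn_integral_distr nn_integral_density)
  also have "\<dots> = (\<integral>\<^sup>+u. indicator (cell l) u * ennreal (jacobian u) * ?h u \<partial>lborel)"
    unfolding cell_density_eq_distr[OF l, symmetric] by (subst nn_integral_density) simp_all
  also have "\<dots> = (\<integral>\<^sup>+u. indicator (cell l) u * ennreal (jacobian u) * (indicator E u * g (map_vec T u)) \<partial>lborel)"
    by (intro nn_integral_cong) (simp add: indicator_def cell_map_eq)
  finally show ?thesis .
qed

lemma allocated_measurable:
  assumes l: "l \<in> cells" shows "allocated l \<in> sets (borel \<Otimes>\<^sub>M borel)"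
proof -
  have [measurable]: "Measurable.pred (borel \<Otimes>\<^sub>M borel) (\<lambda>p. snd p $ i \<in> comp.stratum i (l i) (fst p $ i))" for i
  proof -
    have "(\<lambda>p::(real^'d)\<times>(real^'d). (fst p $ i, snd p $ i)) \<in> measurable (borel \<Otimes>\<^sub>M borel) (borel \<Otimes>\<^sub>M borel)"
      by measurable
    from measurable_compose[OF this comp.stratum_measurable[OF cellsD[OF l]]] show ?thesis by simp
  qed
  have "{p \<in> space (borel \<Otimes>\<^sub>M borel). \<forall>i. snd p $ i \<in> comp.stratum i (l i) (fst p $ i)} \<in>
      sets (borel \<Otimes>\<^sub>M (borel :: (real^'d) measure))"
    by measurable
  then show ?thesis by (simp add: allocated_def space_pair_measure)
qed

lemma stoch_inv_vec_measurable:
  "(\<lambda>p. stoch_inv_vec (fst p) (snd p)) \<in> borel_measurable (borel \<Otimes>\<^sub>M borel)"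
proof -
  have [measurable]: "(\<lambda>p::(real^'d)\<times>(real^'d). stoch_inv (T i) (L i) (a i) (fst p $ i) (snd p $ i)) \<in>
      borel_measurable (borel \<Otimes>\<^sub>M borel)" for i
  proof -
    have "(\<lambda>p::(real^'d)\<times>(real^'d). (fst p $ i, snd p $ i)) \<in> measurable (borel \<Otimes>\<^sub>M borel) (borel \<Otimes>\<^sub>M borel)"
      by measurable
    from measurable_compose[OF this comp.stoch_inv_measurable] show ?thesis by simp
  qed
  show ?thesis unfolding stoch_inv_vec_def by measurable
qed

lemma allocated_cell_image:
  assumes "l \<in> cells" "(v, z) \<in> allocated l"
  shows "v \<in> cell_image l"
proof -
  have "v $ i \<in> T i ` piece (a i) (l i)" for i
    using assms(2) by (intro comp.stratumD(7)[OF cellsD[OF assms(1)]]) (auto simp: allocated_def)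
  then show ?thesis by (simp add: cell_image_def)
qed

lemma allocated_unique:
  assumes "(v, z) \<in> allocated k" "(v, z) \<in> allocated l"
  shows "k = l"
  using assms comp.stratum_unique by (fastforce simp: allocated_def)

lemma stoch_inv_vec_allocated:
  assumes "l \<in> cells" "(v, z) \<in> allocated l"
  shows "stoch_inv_vec v z = cell_inv l v"
proof -
  have "stoch_inv (T i) (L i) (a i) (v $ i) (z $ i) = comp.branch i (l i) (v $ i)" for i
    using assms by (intro comp.stoch_inv_on_stratum cellsD) (auto simp: allocated_def)
  then show ?thesis by (simp add: stoch_inv_vec_def cell_inv_def)
qed

lemma allocated_exhaust:
  assumes v: "v \<in> ocube" "\<And>i. comp.cum i (L i) (v $ i) = 1" and z: "z \<in> ocube"
  obtains l where "l \<in> cells" "(v, z) \<in> allocated l"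
proof -
  have "\<exists>k. k \<in> {1..L i} \<and> z $ i \<in> comp.stratum i k (v $ i)" for i
  proof -
    have "v $ i \<in> {0<..<1}" "0 < z $ i" "z $ i \<le> 1" using v(1) z by (auto simp: less_imp_le)
    from comp.stratum_exhaust[OF this(1) v(2) this(2,3)] show ?thesis by metis
  qed
  then obtain l where "\<And>i. l i \<in> {1..L i} \<and> z $ i \<in> comp.stratum i (l i) (v $ i)" by metis
  then show ?thesis by (intro that[of l]) (auto simp: allocated_def)
qed

text \<open>Almost surely exactly one cell receives the vector of stochastic inverses, and there this vector is
  given by the branches of that cell.\<close>

lemma sum_allocated:
  assumes "v \<in> ocube" "\<And>i. comp.cum i (L i) (v $ i) = 1" "z \<in> ocube"
  shows "(\<Sum>l\<in>cells. indicator (allocated l) (v, z) * h (cell_inv l v)) = (h (stoch_inv_vec v z) :: ennreal)"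
proof -
  obtain l where l: "l \<in> cells" "(v, z) \<in> allocated l" using allocated_exhaust[OF assms] .
  have "(\<Sum>k\<in>cells. indicator (allocated k) (v, z) * h (cell_inv k v)) =
      (\<Sum>k\<in>cells. if k = l then h (cell_inv k v) else 0)"
    using l allocated_unique by (intro sum.cong) (auto simp: indicator_def)
  then show ?thesis using l finite_cells stoch_inv_vec_allocated[OF l] by simp
qed

lemma alloc_prob_eq:
  assumes l: "l \<in> cells"
  shows "alloc_prob \<kappa> T L a l v =
    (if v \<in> ocube then measure (\<kappa> v) {z \<in> ocube. (v, z) \<in> allocated l} else 0)"
proof -
  have "(\<forall>i. stoch_inv (T i) (L i) (a i) (v $ i) (z $ i) \<in> piece (a i) (l i)) \<longleftrightarrow> (v, z) \<in> allocated l"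
    if "z \<in> ocube" for z
    using that comp.stoch_inv_in_piece_iff[OF cellsD[OF l]] by (simp add: allocated_def less_imp_le)
  then have "{z \<in> ocube. \<forall>i. stoch_inv (T i) (L i) (a i) (v $ i) (z $ i) \<in> piece (a i) (l i)} =
      {z \<in> ocube. (v, z) \<in> allocated l}" by blast
  then show ?thesis unfolding alloc_prob_def by (simp only:)
qed

lemma alloc_prob_nonneg: "0 \<le> alloc_prob \<kappa> T L a l v"
  by (simp add: alloc_prob_def)

text \<open>A stratum is nonempty only if the corresponding root exists. This restricts integrals against the
  allocation probability to the image of the cell, where the change of variables applies.\<close>

lemma alloc_prob_outside:
  assumes l: "l \<in> cells" and v: "v \<notin> cell_image l"
  shows "alloc_prob \<kappa> T L a l v = 0"
proof -
  have "{z \<in> ocube. (v, z) \<in> allocated l} = {}" using allocated_cell_image[OF l] v by blast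
  then show ?thesis unfolding alloc_prob_eq[OF l] by (simp only: measure_empty if_cancel)
qed

lemma alloc_prob_measurable:
  assumes l: "l \<in> cells"
    and \<kappa>: "\<kappa> \<in> measurable (restrict_space borel ocube) (prob_algebra (restrict_space borel ocube))"
  shows "alloc_prob \<kappa> T L a l \<in> borel_measurable borel"
proof -
  let ?B = "restrict_space borel (ocube :: (real^'d) set)"
  have sp: "space ?B = ocube" by (simp add: space_restrict_space)
  have "Sigma (space ?B) (\<lambda>v. {z \<in> ocube. (v, z) \<in> allocated l}) \<in> sets (?B \<Otimes>\<^sub>M ?B)"
  proof -
    have "allocated l \<inter> ocube \<times> ocube \<in> sets (?B \<Otimes>\<^sub>M ?B)"
      by (rule Int_ocube_sets[OF allocated_measurable[OF l]])
    also have "allocated l \<inter> ocube \<times> ocube = Sigma (space ?B) (\<lambda>v. {z \<in> ocube. (v, z) \<in> allocated l})"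
      unfolding sp by blast
    finally show ?thesis .
  qed
  from measure_measurable_prob_algebra2[OF this \<kappa>]
  have "(\<lambda>v. if v \<in> ocube then measure (\<kappa> v) {z \<in> ocube. (v, z) \<in> allocated l} else 0) \<in> borel_measurable borel"
    by (subst measurable_restrict_space_iff[symmetric]) simp_all
  then show ?thesis unfolding alloc_prob_eq[OF l, abs_def] .
qed

lemma omega_eq:
  "omega \<kappa> T L a u =
    (\<Sum>l\<in>cells. indicator (cell l) u * alloc_prob \<kappa> T L a l (map_vec T u) * jacobian u)"
  unfolding omega_def cell_def jacobian_def ..

end


section \<open>The law of the multivariate stochastic inverse\<close>

lemma AE_components_of_uniform_margins:
  fixes X :: "'w \<Rightarrow> real ^ 'd::finite"
  assumes X [measurable]: "X \<in> borel_measurable M"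
    and unif: "\<And>i. distr M borel (\<lambda>w. X w $ i) = unif01"
    and P: "\<And>i. AE x in unif01. P i x"
  shows "AE w in M. \<forall>i. P i (X w $ i)"
proof -
  have "AE w in M. P i (X w $ i)" for i
  proof -
    have "AE x in distr M borel (\<lambda>w. X w $ i). P i x" using P[of i] unfolding unif .
    then show ?thesis by (rule AE_distrD[rotated]) measurable
  qed
  then show ?thesis by (simp add: AE_all_countable)
qed

lemma copula_joint_cdf:
  fixes X :: "'w \<Rightarrow> real ^ 'd::finite"
  assumes "prob_space M" and X [measurable]: "X \<in> borel_measurable M"
    and unif: "\<And>i. distr M borel (\<lambda>w. X w $ i) = unif01"
  shows "copula (joint_cdf M X)"
  unfolding copula_def
proof (intro exI[of _ "distr M borel X"] conjI allI ballI)
  interpret prob_space M by fact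
  show "prob_space (distr M borel X)" by (rule prob_space_distr) measurable
  show "distr (distr M borel X) borel (\<lambda>x. x $ i) = unif01" for i
    by (subst distr_distr) (auto simp: comp_def unif)
  fix u :: "real ^ 'd"
  have "{x. \<forall>i. x $ i \<le> u $ i} \<in> sets borel" by measurable
  then show "joint_cdf M X u = measure (distr M borel X) {x. \<forall>i. x $ i \<le> u $ i}"
    unfolding joint_cdf_def
    by (subst measure_distr[OF X]) (auto intro!: arg_cong[where f="measure M"])
qed simp

context udp_partitions begin

text \<open>The law of the vector of stochastic inverses is split over the cells. For each cell, disintegration
  replaces the levels by the allocation probability, and the change of variables moves the integral over
  the image of the cell back to the cell itself.\<close>

lemma distributed_stoch_inv_vec:
  fixes V Z :: "'w \<Rightarrow> real ^ 'd"
  assumes "prob_space M"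
    and V [measurable]: "V \<in> borel_measurable M" and Z [measurable]: "Z \<in> borel_measurable M"
    and V_unif: "\<And>i. distr M borel (\<lambda>w. V w $ i) = unif01"
    and Z_unif: "\<And>i. distr M borel (\<lambda>w. Z w $ i) = unif01"
    and cV_nonneg: "\<And>v. 0 \<le> cV v" and cV: "distributed M lborel V (\<lambda>v. ennreal (cV v))"
    and \<kappa>: "reg_cond_dist M Z V \<kappa>"
  shows "distributed M lborel (\<lambda>w. stoch_inv_vec (V w) (Z w))
    (\<lambda>u. ennreal (cV (map_vec T u) * omega \<kappa> T L a u))"
proof -
  let ?U = "\<lambda>w. stoch_inv_vec (V w) (Z w)"
  let ?c = "\<lambda>u. ennreal (cV (map_vec T u) * omega \<kappa> T L a u)"
  let ?p = "\<lambda>l v. ennreal (alloc_prob \<kappa> T L a l v) * ennreal (cV v)"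
  have kern: "\<kappa> \<in> measurable (restrict_space borel ocube) (prob_algebra (restrict_space borel ocube))"
    using \<kappa> by (simp add: reg_cond_dist_def)
  have cV_m [measurable]: "(\<lambda>v. ennreal (cV v)) \<in> borel_measurable borel"
    using distributed_borel_measurable[OF cV] by simp
  have V_density: "distr M borel V = density lborel (\<lambda>v. ennreal (cV v))"
    using distributed_distr_eq_density[OF cV] by (simp cong: distr_cong)
  have p_m: "?p l \<in> borel_measurable borel" if "l \<in> cells" for l
    using alloc_prob_measurable[OF that kern] by measurable
  have U_m: "?U \<in> borel_measurable M"
    using measurable_compose[OF measurable_Pair stoch_inv_vec_measurable, of V M Z] by simp
  have V_cube: "AE w in M. V w \<in> ocube" and Z_cube: "AE w in M. Z w \<in> ocube"
    using AE_components_of_uniform_margins[OF V V_unif, of "\<lambda>_ x. x \<in> {0<..<1}"]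
      AE_components_of_uniform_margins[OF Z Z_unif, of "\<lambda>_ x. x \<in> {0<..<1}"] AE_unif01 by simp_all
  have V_cum: "AE w in M. \<forall>i. comp.cum i (L i) (V w $ i) = 1"
    by (rule AE_components_of_uniform_margins[OF V V_unif, of "\<lambda>i x. comp.cum i (L i) x = 1"])
       (intro AE_uniform_measureI comp.AE_cum_eq_1, simp)
  have integrand: "ennreal (cV (map_vec T u) * omega \<kappa> T L a u) =
      (\<Sum>l\<in>cells. indicator (cell l) u * ennreal (jacobian u) * ?p l (map_vec T u))" for u
  proof -
    have expand: "cV (map_vec T u) * omega \<kappa> T L a u =
      (\<Sum>l\<in>cells. indicator (cell l) u * jacobian u * (alloc_prob \<kappa> T L a l (map_vec T u) * cV (map_vec T u)))"
      unfolding omega_eq sum_distrib_left by (intro sum.cong refl) (simp add: mult_ac)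
    have "ennreal (cV (map_vec T u) * omega \<kappa> T L a u) =
      (\<Sum>l\<in>cells. ennreal (indicator (cell l) u * jacobian u *
        (alloc_prob \<kappa> T L a l (map_vec T u) * cV (map_vec T u))))"
      unfolding expand
      by (intro sum_ennreal[symmetric] mult_nonneg_nonneg jacobian_nonneg alloc_prob_nonneg cV_nonneg) simp
    also have "\<dots> = (\<Sum>l\<in>cells. indicator (cell l) u * ennreal (jacobian u) * ?p l (map_vec T u))"
      by (intro sum.cong refl)
         (simp add: ennreal_mult jacobian_nonneg alloc_prob_nonneg cV_nonneg ennreal_indicator)
    finally show ?thesis .
  qed
  have summand_m: "(\<lambda>u. indicator (cell l) u * ennreal (jacobian u) * ?p l (map_vec T u)) \<in> borel_measurable borel"
    if l: "l \<in> cells" for l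
  proof -
    have "(\<lambda>u. indicator (cell l) u * ennreal (jacobian u) * ?p l (cell_map l u)) \<in> borel_measurable borel"
      by (rule borel_measurable_times_ennreal[OF cell_jacobian_measurable[OF l]
          measurable_compose[OF cell_map_measurable[OF l] p_m[OF l]]])
    moreover have "indicator (cell l) u * ennreal (jacobian u) * ?p l (cell_map l u) =
        indicator (cell l) u * ennreal (jacobian u) * ?p l (map_vec T u)" for u
      by (cases "u \<in> cell l") (simp_all add: cell_map_eq)
    ultimately show ?thesis by simp
  qed
  \<comment> \<open>the contribution of a single cell to the probability of an event\<close>
  have cell_prob: "(\<integral>\<^sup>+w. indicator (allocated l) (V w, Z w) * indicator E (cell_inv l (V w)) \<partial>M) =
      (\<integral>\<^sup>+u. indicator (cell l) u * ennreal (jacobian u) * (indicator E u * ?p l (map_vec T u)) \<partial>lborel)"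
    if l: "l \<in> cells" and E: "E \<in> sets borel" for l E
  proof -
    \<comment> \<open>on the cell the event U in E is a condition on V alone, since U is the branch inverse of V there\<close>
    let ?D = "{p \<in> allocated l. cell_inv l (fst p) \<in> E}"
    have D: "?D \<in> sets (borel \<Otimes>\<^sub>M borel)"
    proof -
      have "(\<lambda>p::(real^'d)\<times>(real^'d). cell_inv l (fst p)) \<in> measurable (borel \<Otimes>\<^sub>M borel) borel"
        using cell_inv_measurable[OF l] by measurable
      from measurable_sets[OF this E] have "allocated l \<inter> (\<lambda>p. cell_inv l (fst p)) -` E \<in> sets (borel \<Otimes>\<^sub>M borel)"
        using allocated_measurable[OF l] by (intro sets.Int) (simp_all add: space_pair_measure)
      also have "allocated l \<inter> (\<lambda>p. cell_inv l (fst p)) -` E = ?D" by blast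
      finally show ?thesis .
    qed
    have "(\<integral>\<^sup>+w. indicator (allocated l) (V w, Z w) * indicator E (cell_inv l (V w)) \<partial>M) =
        (\<integral>\<^sup>+w. indicator {w \<in> space M. (V w, Z w) \<in> ?D} w \<partial>M)"
      by (intro nn_integral_cong) (simp add: indicator_def)
    also have "\<dots> = emeasure M {w \<in> space M. (V w, Z w) \<in> ?D}"
      using measurable_sets[OF measurable_Pair[OF V Z] D]
      by (intro nn_integral_indicator) (simp add: vimage_def Int_def conj_commute)
    also have "\<dots> = (\<integral>\<^sup>+v. emeasure (\<kappa> v) {z \<in> ocube. (v, z) \<in> ?D} * indicator ocube v \<partial>distr M borel V)"
      by (rule reg_cond_dist_emeasure[OF \<open>prob_space M\<close> V Z V_cube Z_cube \<kappa> D])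
    also have "\<dots> = (\<integral>\<^sup>+v. indicator (cell_image l) v * (indicator E (cell_inv l v) *
        ennreal (alloc_prob \<kappa> T L a l v)) \<partial>distr M borel V)"
    proof (intro nn_integral_cong)
      fix v
      show "emeasure (\<kappa> v) {z \<in> ocube. (v, z) \<in> ?D} * indicator ocube v =
        indicator (cell_image l) v * (indicator E (cell_inv l v) * ennreal (alloc_prob \<kappa> T L a l v))"
      proof (cases "v \<in> ocube")
        case True
        have "v \<in> space (restrict_space borel ocube)" using True by (simp add: space_restrict_space)
        then have "\<kappa> v \<in> space (prob_algebra (restrict_space borel ocube))"
          by (rule measurable_space[OF kern])
        then interpret K: prob_space "\<kappa> v" by (simp add: space_prob_algebra)
        have "emeasure (\<kappa> v) {z \<in> ocube. (v, z) \<in> ?D} =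
            indicator E (cell_inv l v) * emeasure (\<kappa> v) {z \<in> ocube. (v, z) \<in> allocated l}"
          by (simp add: indicator_def)
        also have "emeasure (\<kappa> v) {z \<in> ocube. (v, z) \<in> allocated l} = ennreal (alloc_prob \<kappa> T L a l v)"
          unfolding alloc_prob_eq[OF l] K.emeasure_eq_measure using True by (simp only: if_True)
        finally show ?thesis
          using True alloc_prob_outside[OF l, of v \<kappa>] by (cases "v \<in> cell_image l") auto
      next
        case False
        then have "alloc_prob \<kappa> T L a l v = 0" unfolding alloc_prob_def by (simp only: if_False)
        then show ?thesis using False by (simp only: indicator_simps) simp
      qed
    qed
    also have "\<dots> = (\<integral>\<^sup>+v. indicator (cell_image l) v * (indicator E (cell_inv l v) * ?p l v) \<partial>lborel)"
    proof -
      note [measurable] = cell_image_borel[OF l] cell_inv_measurable[OF l] alloc_prob_measurable[OF l kern] E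
      show ?thesis unfolding V_density by (subst nn_integral_density) (simp_all add: mult_ac)
    qed
    also have "\<dots> = (\<integral>\<^sup>+u. indicator (cell l) u * ennreal (jacobian u) * (indicator E u * ?p l (map_vec T u)) \<partial>lborel)"
      by (rule nn_integral_cell[OF l E p_m[OF l]])
    finally show ?thesis .
  qed
  have c_m: "?c \<in> borel_measurable borel"
    unfolding integrand by (intro borel_measurable_sum summand_m)
  have "distr M lborel ?U = density lborel ?c"
  proof (rule measure_eqI)
    fix E assume "E \<in> sets (distr M lborel ?U)"
    then have E [measurable]: "E \<in> sets borel" by simp
    have "emeasure (distr M lborel ?U) E = (\<integral>\<^sup>+u. indicator E u \<partial>distr M lborel ?U)" by simp
    also have "\<dots> = (\<integral>\<^sup>+w. indicator E (?U w) \<partial>M)"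
      using U_m by (subst nn_integral_distr) simp_all
    also have "\<dots> = (\<integral>\<^sup>+w. (\<Sum>l\<in>cells. indicator (allocated l) (V w, Z w) * indicator E (cell_inv l (V w))) \<partial>M)"
    proof (rule nn_integral_cong_AE)
      show "AE w in M. indicator E (?U w) =
        (\<Sum>l\<in>cells. indicator (allocated l) (V w, Z w) * indicator E (cell_inv l (V w)) :: ennreal)"
        using V_cube Z_cube V_cum
      proof eventually_elim
        case (elim w)
        then show ?case by (intro sum_allocated[symmetric]) blast+
      qed
    qed
    also have "\<dots> = (\<Sum>l\<in>cells. \<integral>\<^sup>+w. indicator (allocated l) (V w, Z w) * indicator E (cell_inv l (V w)) \<partial>M)"
    proof (rule nn_integral_sum)
      fix l assume l: "l \<in> cells"
      note [measurable] = allocated_measurable[OF l] cell_inv_measurable[OF l]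
      show "(\<lambda>w. indicator (allocated l) (V w, Z w) * indicator E (cell_inv l (V w)) :: ennreal) \<in> borel_measurable M"
        by measurable
    qed
    also have "\<dots> = (\<Sum>l\<in>cells. \<integral>\<^sup>+u. indicator (cell l) u * ennreal (jacobian u) * ?p l (map_vec T u) * indicator E u \<partial>lborel)"
      by (intro sum.cong refl, subst cell_prob[OF _ E]) (simp_all add: mult_ac)
    also have "\<dots> = (\<integral>\<^sup>+u. (\<Sum>l\<in>cells. indicator (cell l) u * ennreal (jacobian u) * ?p l (map_vec T u) * indicator E u) \<partial>lborel)"
      using summand_m E by (intro nn_integral_sum[symmetric]) simp
    also have "\<dots> = (\<integral>\<^sup>+u. ?c u * indicator E u \<partial>lborel)"
      unfolding integrand sum_distrib_right ..
    also have "\<dots> = emeasure (density lborel ?c) E"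
      using c_m by (subst emeasure_density) simp_all
    finally show "emeasure (distr M lborel ?U) E = emeasure (density lborel ?c) E" .
  qed simp
  then show ?thesis unfolding distributed_def using c_m U_m by simp
qed

end

theorem theorem2:
  fixes M :: "'w measure"
    and T :: "'d::finite \<Rightarrow> real \<Rightarrow> real"
    and L :: "'d \<Rightarrow> nat"
    and a :: "'d \<Rightarrow> nat \<Rightarrow> real"
    and V Z :: "'w \<Rightarrow> real ^ 'd"
    and cV :: "real ^ 'd \<Rightarrow> real"
    and \<kappa> :: "real ^ 'd \<Rightarrow> (real ^ 'd) measure"
  assumes "prob_space M"
    and "\<And>i. regular_udp (T i)"
    and "\<And>i. regular_on (T i) (L i) (a i)"
    and "V \<in> borel_measurable M" and "Z \<in> borel_measurable M"
    and "\<And>i. distr M borel (\<lambda>w. V w $ i) = unif01"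
    and "\<And>i. distr M borel (\<lambda>w. Z w $ i) = unif01"
    and "\<And>i. prob_space.indep_var M borel (\<lambda>w. V w $ i) borel (\<lambda>w. Z w $ i)"
    and "has_copula_density M V cV"
    and "reg_cond_dist M Z V \<kappa>"
  shows "has_copula_density M
           (\<lambda>w. \<chi> i. stoch_inv (T i) (L i) (a i) (V w $ i) (Z w $ i))
           (\<lambda>u. cV (map_vec T u) * omega \<kappa> T L a u)"
proof -
  interpret udp_partitions T L a
    using assms(2,3) by unfold_locales (auto simp: regular_udp_def)
  let ?U = "\<lambda>w. \<chi> i. stoch_inv (T i) (L i) (a i) (V w $ i) (Z w $ i)"
  have cV: "\<And>v. 0 \<le> cV v" "distributed M lborel V (\<lambda>v. ennreal (cV v))"
    using assms(9) by (auto simp: has_copula_density_def)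
  have dist: "distributed M lborel ?U (\<lambda>u. ennreal (cV (map_vec T u) * omega \<kappa> T L a u))"
    using distributed_stoch_inv_vec[OF assms(1,4-7) cV assms(10)] by (simp add: stoch_inv_vec_def)
  have U_m: "?U \<in> borel_measurable M"
    using distributed_measurable[OF dist] by simp
  have "distr M borel (\<lambda>w. ?U w $ i) = unif01" for i
    using comp.distr_stoch_inv[OF assms(1,6,7,8)] by simp
  then have "copula (joint_cdf M ?U)" by (intro copula_joint_cdf assms(1) U_m)
  moreover have "0 \<le> cV (map_vec T u) * omega \<kappa> T L a u" for u
    unfolding omega_eq
    by (intro mult_nonneg_nonneg cV sum_nonneg jacobian_nonneg alloc_prob_nonneg) simp
  ultimately show ?thesis using dist by (simp add: has_copula_density_def)
qed

end
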